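(* Let $k,l$ be integers with $k \geq 2$ and $0 \leq l \leq 2k-1$. Then there is no planarizing gadget for the class of $(k,l)$-sparse graphs; that is, there is no finite graph $\Gamma$ with four distinguished vertices $a,b,c,d$ such that $\Gamma$ has a planar embedding in which $a,c,b,d$ appear on the outer face in this order, and such that for every graph $G$ and every drawing of $G$ in the plane in which two edges $ab$ and $cd$ cross, the graph $G' = G - \{ab,cd\} + \Gamma$ is $(k,l)$-sparse if and only if $G$ is $(k,l)$-sparse.
   Context: Graphs may be multigraphs. For a graph $G=(V,E)$ and $S \subseteq V$, $E[S]$ denotes the set of edges of $G$ with both endpoints in $S$. For integers $k,l$, a graph $G=(V,E)$ is $(k,l)$-sparse if every $S \subseteq V$ with $|S| \geq 2$ satisfies $|E[S]| \leq k|S|-l$. Given a graph $G$ with a drawing in the plane in which edges $ab$ and $cd$ cross, and a graph $\Gamma$ containing distinct vertices $a,b,c,d$, the graph $G' = G - \{ab,cd\} + \Gamma$ is obtained by deleting the edges $ab$ and $cd$ from $G$ and adding a copy of $\Gamma$ whose vertices $a,b,c,d$ are identified with the vertices $a,b,c,d$ of $G$ (all other vertices and all edges of $\Gamma$ being new). For a class $L$ of graphs, a graph $\Gamma$ of constant size with a planar embedding in which $a,c,b,d$ appear on the outer face in this order is a planarizing gadget for $L$ if $G \in L \Leftrightarrow G' \in L$ for every such $G$ and drawing. *)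

theory Defs
  imports "HOL-Analysis.Analysis"
begin

section \<open>Multigraphs and sparsity\<close>

text \<open>
  Undirected multigraphs: edges are named objects, so parallel edges are distinct edges with the
  same set of ends; a loop is an edge with a single end.
\<close>

record ('v, 'e) multigraph =
  verts :: "'v set"
  edges :: "'e set"
  ends :: "'e \<Rightarrow> 'v set"

definition finite_multigraph :: "('v, 'e) multigraph \<Rightarrow> bool" where
  "finite_multigraph G \<longleftrightarrow>
     finite (verts G) \<and> finite (edges G) \<and>
     (\<forall>e\<in>edges G. ends G e \<subseteq> verts G \<and> card (ends G e) \<in> {1, 2})"

definition induced_edges :: "('v, 'e) multigraph \<Rightarrow> 'v set \<Rightarrow> 'e set" where
  "induced_edges G S = {e \<in> edges G. ends G e \<subseteq> S}"

definition sparse :: "int \<Rightarrow> int \<Rightarrow> ('v, 'e) multigraph \<Rightarrow> bool" where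
  "sparse k l G \<longleftrightarrow>
     (\<forall>S\<subseteq>verts G. card S \<ge> 2 \<longrightarrow> int (card (induced_edges G S)) \<le> k * int (card S) - l)"

text \<open>
  A class of graphs is a set of graphs whose vertices and edges are natural numbers; every finite
  multigraph is isomorphic to such a graph.
\<close>

definition sparse_graphs :: "int \<Rightarrow> int \<Rightarrow> (nat, nat) multigraph set" where
  "sparse_graphs k l = {G. finite_multigraph G \<and> sparse k l G}"


section \<open>Drawings in the plane\<close>

text \<open>
  The curve of an edge is a \<^const>\<open>simple_path\<close>: an arc if the edge has two ends, a simple closed
  curve if it is a loop.
\<close>

definition drawing ::
  "('v, 'e) multigraph \<Rightarrow> ('v \<Rightarrow> complex) \<Rightarrow> ('e \<Rightarrow> real \<Rightarrow> complex) \<Rightarrow> bool" where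
  "drawing G p \<gamma> \<longleftrightarrow>
     inj_on p (verts G) \<and>
     (\<forall>e\<in>edges G. simple_path (\<gamma> e) \<and>
        {pathstart (\<gamma> e), pathfinish (\<gamma> e)} = p ` ends G e \<and>
        path_image (\<gamma> e) \<inter> p ` verts G = p ` ends G e) \<and>
     (\<forall>e\<in>edges G. \<forall>f\<in>edges G. e \<noteq> f \<longrightarrow>
        finite (path_image (\<gamma> e) \<inter> path_image (\<gamma> f)))"

definition drawn_set ::
  "('v, 'e) multigraph \<Rightarrow> ('v \<Rightarrow> complex) \<Rightarrow> ('e \<Rightarrow> real \<Rightarrow> complex) \<Rightarrow> complex set" where
  "drawn_set G p \<gamma> = p ` verts G \<union> (\<Union>e\<in>edges G. path_image (\<gamma> e))"

definition planar_embedding ::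
  "('v, 'e) multigraph \<Rightarrow> ('v \<Rightarrow> complex) \<Rightarrow> ('e \<Rightarrow> real \<Rightarrow> complex) \<Rightarrow> bool" where
  "planar_embedding G p \<gamma> \<longleftrightarrow>
     drawing G p \<gamma> \<and>
     (\<forall>e\<in>edges G. \<forall>f\<in>edges G. e \<noteq> f \<longrightarrow>
        path_image (\<gamma> e) \<inter> path_image (\<gamma> f) \<subseteq> p ` verts G)"

text \<open>
  Two sets cross at \<open>x\<close> if near \<open>x\<close> they look, up to a homeomorphism, like the two coordinate axes
  near the origin. This excludes curves that merely touch.
\<close>

definition cross_at :: "complex set \<Rightarrow> complex set \<Rightarrow> complex \<Rightarrow> bool" where
  "cross_at A B x \<longleftrightarrow>
     (\<exists>U h h'. open U \<and> x \<in> U \<and> homeomorphism U (ball 0 1) h h' \<and> h x = 0 \<and>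
        h ` (A \<inter> U) = {z \<in> ball 0 1. Im z = 0} \<and>
        h ` (B \<inter> U) = {z \<in> ball 0 1. Re z = 0})"

definition edges_cross ::
  "('v, 'e) multigraph \<Rightarrow> ('v \<Rightarrow> complex) \<Rightarrow> ('e \<Rightarrow> real \<Rightarrow> complex) \<Rightarrow> 'e \<Rightarrow> 'e \<Rightarrow> bool" where
  "edges_cross G p \<gamma> e f \<longleftrightarrow>
     (\<exists>x. x \<notin> p ` verts G \<and> cross_at (path_image (\<gamma> e)) (path_image (\<gamma> f)) x)"

text \<open>
  The outer face of an embedding with drawn set \<open>X\<close> is \<open>outside X\<close>, the unbounded component of the
  complement. Its boundary need not be a simple closed curve (nor connected), so the cyclic order
  of points on it is read off from a simple closed curve that surrounds \<open>X\<close>, runs within the outer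
  face apart from the four points, and visits these in the given order. The order is thus
  understood up to rotation and reflection; a cut vertex, which may be met several times along the
  outer boundary, is visited at one of its occurrences.
\<close>

definition on_outer_face_in_order ::
  "complex set \<Rightarrow> complex \<Rightarrow> complex \<Rightarrow> complex \<Rightarrow> complex \<Rightarrow> bool" where
  "on_outer_face_in_order X w x y z \<longleftrightarrow>
     {w, x, y, z} \<subseteq> X \<inter> frontier (outside X) \<and>
     (\<exists>c r s t. simple_path c \<and> pathfinish c = pathstart c \<and>
        0 < r \<and> r < s \<and> s < t \<and> t < 1 \<and>
        c 0 = w \<and> c r = x \<and> c s = y \<and> c t = z \<and>
        path_image c - {w, x, y, z} \<subseteq> outside X \<and>
        X \<subseteq> path_image c \<union> inside (path_image c))"


section \<open>Planarizing gadgets\<close>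

text \<open>
  \<open>H\<close> is obtained from \<open>G\<close> by deleting the edges \<open>e\<close> and \<open>f\<close> and adding a copy of \<open>\<Gamma>\<close>
  (via \<open>\<phi>\<close> on vertices and \<open>\<psi>\<close> on edges) whose vertices \<open>a, b, c, d\<close> are identified with the
  vertices \<open>a', b', c', d'\<close> of \<open>G\<close>.
\<close>

definition gadget_replacement ::
  "('v, 'e) multigraph \<Rightarrow> 'e \<Rightarrow> 'e \<Rightarrow> 'v \<Rightarrow> 'v \<Rightarrow> 'v \<Rightarrow> 'v \<Rightarrow>
   ('a, 'b) multigraph \<Rightarrow> 'a \<Rightarrow> 'a \<Rightarrow> 'a \<Rightarrow> 'a \<Rightarrow> ('v, 'e) multigraph \<Rightarrow> bool" where
  "gadget_replacement G e f a' b' c' d' \<Gamma> a b c d H \<longleftrightarrow>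
     (\<exists>\<phi> \<psi>. inj_on \<phi> (verts \<Gamma>) \<and> inj_on \<psi> (edges \<Gamma>) \<and>
        \<phi> a = a' \<and> \<phi> b = b' \<and> \<phi> c = c' \<and> \<phi> d = d' \<and>
        \<phi> ` (verts \<Gamma> - {a, b, c, d}) \<inter> verts G = {} \<and>
        \<psi> ` edges \<Gamma> \<inter> edges G = {} \<and>
        verts H = verts G \<union> \<phi> ` verts \<Gamma> \<and>
        edges H = (edges G - {e, f}) \<union> \<psi> ` edges \<Gamma> \<and>
        (\<forall>g\<in>edges G - {e, f}. ends H g = ends G g) \<and>
        (\<forall>g\<in>edges \<Gamma>. ends H (\<psi> g) = \<phi> ` ends \<Gamma> g))"

definition planarizing_gadget ::
  "(nat, nat) multigraph set \<Rightarrow> ('a, 'b) multigraph \<Rightarrow> 'a \<Rightarrow> 'a \<Rightarrow> 'a \<Rightarrow> 'a \<Rightarrow> bool" where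
  "planarizing_gadget L \<Gamma> a b c d \<longleftrightarrow>
     finite_multigraph \<Gamma> \<and> {a, b, c, d} \<subseteq> verts \<Gamma> \<and> distinct [a, b, c, d] \<and>
     (\<exists>p \<gamma>. planar_embedding \<Gamma> p \<gamma> \<and>
        on_outer_face_in_order (drawn_set \<Gamma> p \<gamma>) (p a) (p c) (p b) (p d)) \<and>
     (\<forall>G p \<gamma> e f a' b' c' d' H.
        finite_multigraph G \<and> drawing G p \<gamma> \<and>
        e \<in> edges G \<and> f \<in> edges G \<and> ends G e = {a', b'} \<and> ends G f = {c', d'} \<and>
        distinct [a', b', c', d'] \<and> edges_cross G p \<gamma> e f \<and>
        gadget_replacement G e f a' b' c' d' \<Gamma> a b c d H \<longrightarrow>
        (G \<in> L \<longleftrightarrow> H \<in> L))"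

end

theory Submission
  imports Defs
begin

text \<open>
  Write \<open>i W\<close> for the number of edges of \<open>\<Gamma>\<close> inside \<open>W\<close> and \<open>T = {a, b, c, d}\<close>. Replacing the crossing in
  suitable tight or barely non-sparse graphs \<open>G\<close> shows that \<open>i W - k |W - T|\<close> is at most \<open>0\<close> if \<open>W\<close>
  contains just one terminal, at most \<open>2\<close> if it contains all four, and that it is positive for some
  \<open>X\<close> with terminals \<open>a, b\<close> and some \<open>Y\<close> with terminals \<open>c, d\<close>. As \<open>i\<close> is supermodular,
  \<open>Z = X \<inter> Y\<close> satisfies \<open>i Z \<ge> k |Z|\<close>. If \<open>Z\<close> separated \<open>a\<close> from \<open>b\<close> within \<open>X\<close>, then the bounds for
  the two sides (each together with \<open>Z\<close>) would add up to \<open>i X \<le> k |X - T|\<close>; hence \<open>a\<close> and \<open>b\<close> are joined by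
  a path in \<open>X - Y\<close>, and likewise \<open>c\<close> and \<open>d\<close> in \<open>Y\<close>. These disjoint paths contradict the
  order \<open>a, c, b, d\<close> on the outer face.
\<close>

section \<open>Paths inside a simple closed curve\<close>

text \<open>An arc \<open>P\<close> in \<open>A\<close> from \<open>c 0\<close> to
  \<open>c s\<close> cuts the inside of \<open>c\<close> into two regions, each bounded by
  \<open>P\<close> and one of the two arcs of \<open>c\<close> between these points. A disjoint arc
  \<open>Q\<close> in \<open>B\<close> has its interior in one region, so both its ends lie on the
  same arc of \<open>c\<close>; but \<open>c r\<close> and \<open>c t\<close> are on different
  ones.\<close>

lemma inscribed_paths_meet:
  fixes c :: "real \<Rightarrow> complex"
  assumes c: "simple_path c" "pathfinish c = pathstart c"
    and rst: "0 < r" "r < s" "s < t" "t < 1"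
    and A: "path_component A (c 0) (c s)" and B: "path_component B (c r) (c t)"
    and sub: "A \<union> B \<subseteq> path_image c \<union> inside (path_image c)"
    and bd: "(A \<union> B) \<inter> path_image c \<subseteq> {c 0, c r, c s, c t}"
  shows "A \<inter> B \<noteq> {}"
proof
  assume disj: "A \<inter> B = {}"
  have inj: "x = y \<or> x = 0 \<and> y = 1 \<or> x = 1 \<and> y = 0"
    if "x \<in> {0..1}" "y \<in> {0..1}" "c x = c y" for x y
    using c(1) that by (auto simp: simple_path_def loop_free_def)
  have c01: "c 1 = c 0" using c(2) by (simp add: pathfinish_def pathstart_def)
  have neq: "c 0 \<noteq> c s" "c r \<noteq> c t"
    using inj[of 0 s] inj[of r t] rst by auto
  obtain P where P: "arc P" "path_image P \<subseteq> A" "pathstart P = c 0" "pathfinish P = c s"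
    using A neq(1) path_contains_arc unfolding path_component_def
    by (metis order_trans)
  obtain Q where Q: "arc Q" "path_image Q \<subseteq> B" "pathstart Q = c r" "pathfinish Q = c t"
    using B neq(2) path_contains_arc unfolding path_component_def
    by (metis order_trans)
  have Pends: "c 0 \<in> path_image P" "c s \<in> path_image P" and Qends: "c r \<in> path_image Q" "c t \<in> path_image Q"
    using P Q by (metis pathstart_in_path_image pathfinish_in_path_image)+
  have PQ: "path_image P \<inter> path_image Q = {}" using P(2) Q(2) disj by blast
  \<comment> \<open>\<open>c2\<close> is run backwards, from parameter 1 to \<open>s\<close>, so
    that \<open>c1\<close>, \<open>c2\<close> and \<open>P\<close> all lead from \<open>c 0\<close>
    to \<open>c s\<close>, as splitting the inside of \<open>c\<close> along \<open>P\<close>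
    demands.\<close>
  define c1 where "c1 = subpath 0 s c"
  define c2 where "c2 = subpath 1 s c"
  have I: "path_image c1 = c ` {0..s}" "path_image c2 = c ` {s..1}"
    using rst by (auto simp: c1_def c2_def path_image_subpath)
  have pc: "path_image c1 \<union> path_image c2 = path_image c"
    unfolding I using rst by (auto simp: path_image_def image_iff) (smt (verit) atLeastAtMost_iff)
  have Pc: "path_image P \<inter> path_image c = {c 0, c s}"
  proof
    show "path_image P \<inter> path_image c \<subseteq> {c 0, c s}"
      using bd P(2) PQ Qends by blast
    show "{c 0, c s} \<subseteq> path_image P \<inter> path_image c"
      using Pends rst by (auto simp: path_image_def)
  qed
  have Qc: "path_image Q \<inter> path_image c \<subseteq> {c r, c t}"
    using bd Q(2) PQ Pends by blast
  have sp: "simple_path c1" "simple_path c2"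
    using c(1) rst by (auto simp: c1_def c2_def intro!: simple_path_subpath)
  have cc: "path_image c1 \<inter> path_image c2 = {c 0, c s}"
  proof
    show "path_image c1 \<inter> path_image c2 \<subseteq> {c 0, c s}"
    proof
      fix z assume "z \<in> path_image c1 \<inter> path_image c2"
      then obtain x y where xy: "x \<in> {0..s}" "y \<in> {s..1}" "z = c x" "z = c y" by (auto simp: I)
      then have "x = y \<or> x = 0 \<and> y = 1 \<or> x = 1 \<and> y = 0" using rst by (intro inj) auto
      then show "z \<in> {c 0, c s}" using xy rst by auto
    qed
    show "{c 0, c s} \<subseteq> path_image c1 \<inter> path_image c2"
      using rst c01 by (auto simp: I image_iff intro: bexI[of _ 0] bexI[of _ s] bexI[of _ 1])
  qed
  have cP: "path_image c1 \<inter> path_image P = {c 0, c s}" "path_image c2 \<inter> path_image P = {c 0, c s}"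
    using Pc cc pc by blast+
  have "path_image P - {c 0, c s} \<noteq> {}"
    using nonempty_simple_path_endless[of P] P arc_imp_simple_path[of P] by simp
  then have ne: "path_image P \<inter> inside (path_image c1 \<union> path_image c2) \<noteq> {}"
    unfolding pc using P(2) sub Pc by blast
  obtain
    i1: "inside(path_image c1 \<union> path_image P) \<inter> inside(path_image c2 \<union> path_image P) = {}" and
    i2: "inside(path_image c1 \<union> path_image P) \<union> inside(path_image c2 \<union> path_image P) \<union>
           (path_image P - {c 0, c s}) = inside(path_image c1 \<union> path_image c2)"
    by (rule split_inside_simple_closed_curve[of c1 "c 0" "c s" c2 P])
      (use sp P neq cc cP ne arc_imp_simple_path[OF P(1)] c01 in \<open>auto simp: c1_def c2_def\<close>)
  define I1 where "I1 = inside(path_image c1 \<union> path_image P)"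
  define I2 where "I2 = inside(path_image c2 \<union> path_image P)"
  have cl: "closed (path_image c1 \<union> path_image P)" "closed (path_image c2 \<union> path_image P)"
    using sp P(1) by (auto intro!: closed_Un closed_simple_path_image arc_imp_simple_path)
  then have op: "open I1" "open I2" by (auto simp: I1_def I2_def open_inside)
  define Q' where "Q' = path_image Q - {c r, c t}"
  have conn: "connected Q'"
    unfolding Q'_def using connected_simple_path_endless[of Q] Q arc_imp_simple_path by auto
  have clQ: "{c r, c t} \<subseteq> closure Q'"
  proof -
    have "Q ` {0<..<1} \<subseteq> Q'"
      using Q(1) unfolding Q'_def arc_def Q(3,4)[symmetric] pathstart_def pathfinish_def path_image_def
      by (auto dest!: inj_onD)
    then have "Q ` closure {0<..<1} \<subseteq> closure Q'"
      using Q(1) closure_subset[of Q']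
      by (intro image_closure_subset) (auto simp: arc_def path_def)
    then have "Q 0 \<in> closure Q'" "Q 1 \<in> closure Q'" by auto
    then show ?thesis using Q(3,4) by (simp add: pathstart_def pathfinish_def)
  qed
  have "Q' \<subseteq> inside (path_image c)" using sub Q(2) Qc unfolding Q'_def by blast
  then have Q12: "Q' \<subseteq> I1 \<union> I2"
    using i2 PQ unfolding pc I1_def I2_def Q'_def by blast
  have "I1 \<inter> Q' = {} \<or> I2 \<inter> Q' = {}"
    using connectedD[OF conn op _ Q12] i1 unfolding I1_def I2_def by blast
  then have "Q' \<subseteq> I1 \<or> Q' \<subseteq> I2" using Q12 by blast
  then have 1: "closure Q' \<subseteq> closure I1 \<or> closure Q' \<subseteq> closure I2" by (meson closure_mono)
  have 2: "I1 \<union> I2 \<subseteq> inside (path_image c)" using i2 unfolding pc I1_def I2_def by blast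
  have 3: "closure I1 \<subseteq> path_image c1 \<union> path_image P \<union> I1"
    "closure I2 \<subseteq> path_image c2 \<union> path_image P \<union> I2"
    using cl closure_inside_subset unfolding I1_def I2_def by blast+
  have 4: "c r \<in> path_image c1" "c t \<in> path_image c2" using rst by (auto simp: I)
  have 5: "c r \<notin> path_image P" "c t \<notin> path_image P" using Qends PQ by blast+
  have "c r \<notin> inside (path_image c)" "c t \<notin> inside (path_image c)"
    using 4 pc inside_no_overlap[of "path_image c"] by blast+
  \<comment> \<open>If \<open>Q'\<close> lies in \<open>I1\<close>, its limit point
    \<open>c t\<close> is in the closure of \<open>I1\<close>; being neither on \<open>P\<close> nor
    inside \<open>c\<close>, it is on \<open>c1\<close>. The case of \<open>I2\<close> puts
    \<open>c r\<close> on \<open>c2\<close>.\<close>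
  then have "c t \<in> path_image c1 \<or> c r \<in> path_image c2"
    using 1 2 3 5 clQ by blast
  then have "c t \<in> {c 0, c s} \<or> c r \<in> {c 0, c s}"
    using cc 4 by blast
  then show False using inj[of t 0] inj[of t s] inj[of r 0] inj[of r s] rst by auto
qed


section \<open>Drawing the test graphs\<close>

text \<open>
  The part of the parabola \<open>y = h (x - u) (v - x)\<close> above the real segment from \<open>u\<close> to \<open>v\<close>. Two such
  parabolas with different data meet at most twice.
\<close>

definition arch :: "real \<Rightarrow> real \<Rightarrow> real \<Rightarrow> real \<Rightarrow> complex" where
  "arch h u v t = Complex (u + t * (v - u)) (h * (t * (v - u)) * ((1 - t) * (v - u)))"

lemma path_image_arch:
  assumes "u < v"
  shows "path_image (arch h u v) = {z. u \<le> Re z \<and> Re z \<le> v \<and> Im z = h * (Re z - u) * (v - Re z)}"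
proof -
  have "\<exists>t\<in>{0..1}. z = arch h u v t"
    if "u \<le> Re z" "Re z \<le> v" "Im z = h * (Re z - u) * (v - Re z)" for z
  proof -
    define t where "t = (Re z - u) / (v - u)"
    have t: "t * (v - u) = Re z - u" "(1 - t) * (v - u) = v - Re z"
      using assms by (auto simp: t_def field_simps)
    have "z = arch h u v t" unfolding arch_def t using that(3) by (simp add: complex_eq_iff)
    moreover have "t \<in> {0..1}" using that assms by (auto simp: t_def field_simps)
    ultimately show ?thesis by blast
  qed
  moreover have "u \<le> Re (arch h u v t) \<and> Re (arch h u v t) \<le> v \<and>
      Im (arch h u v t) = h * (Re (arch h u v t) - u) * (v - Re (arch h u v t))"
    if "t \<in> {0..1}" for t
    using that assms mult_left_le_one_le[of "v - u" t]
    by (auto simp: arch_def algebra_simps)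
       (smt (verit) mult_left_mono)
  ultimately show ?thesis
    unfolding path_image_def by blast
qed

lemma simple_path_arch:
  assumes "u < v"
  shows "simple_path (arch h u v)"
proof -
  have "x = y" if "arch h u v x = arch h u v y" for x y
    using that assms by (simp add: arch_def)
  moreover have "path (arch h u v)"
    unfolding path_def arch_def Complex_eq by (intro continuous_intros)
  ultimately show ?thesis by (auto simp: simple_path_def loop_free_def)
qed

lemma pathstart_arch [simp]: "pathstart (arch h u v) = complex_of_real u"
  and pathfinish_arch [simp]: "pathfinish (arch h u v) = complex_of_real v"
  by (auto simp: arch_def pathstart_def pathfinish_def complex_eq_iff)

text \<open>Equating the two heights gives a polynomial \<open>q\<close> of degree at most 2 in the
  real part. By \<open>ne\<close>, its quadratic coefficient is nonzero, or that one vanishes and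
  the linear one does not.\<close>

lemma finite_arch_Int_arch:
  assumes "u < v" "u' < v'" and ne: "h \<noteq> h' \<or> h \<noteq> 0 \<and> u + v \<noteq> u' + v'"
  shows "finite (path_image (arch h u v) \<inter> path_image (arch h' u' v'))"
proof -
  define q where "q = [:h' * u' * v' - h * u * v, h * (u + v) - h' * (u' + v'), h' - h:]"
  have "q \<noteq> 0" using ne by (auto simp: q_def)
  then have "finite {x. poly q x = 0}" by (rule poly_roots_finite)
  then have "finite ((\<lambda>x. Complex x (h * (x - u) * (v - x))) ` {x. poly q x = 0})" by simp
  moreover have "z \<in> (\<lambda>x. Complex x (h * (x - u) * (v - x))) ` {x. poly q x = 0}"
    if "Im z = h * (Re z - u) * (v - Re z)" "Im z = h' * (Re z - u') * (v' - Re z)" for z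
  proof (intro image_eqI)
    show "z = Complex (Re z) (h * (Re z - u) * (v - Re z))" using that by (simp add: complex_eq_iff)
    show "Re z \<in> {x. poly q x = 0}" using that unfolding q_def by (simp add: algebra_simps)
  qed
  then have "path_image (arch h u v) \<inter> path_image (arch h' u' v')
      \<subseteq> (\<lambda>x. Complex x (h * (x - u) * (v - x))) ` {x. poly q x = 0}"
    using assms(1,2) by (auto simp: path_image_arch)
  ultimately show ?thesis by (rule finite_subset[rotated])
qed

lemma cross_at_arches:
  "cross_at (path_image (arch 1 0 2)) (path_image (arch 1 1 3)) (Complex (3/2) (3/4))"
proof -
  \<comment> \<open>The difference of the two parabolas is linear, so measuring the vertical distances to both is a
    global change of coordinates; the factor 2 keeps the unit ball above \<open>[1, 2]\<close>.\<close>
  define k :: "complex \<Rightarrow> complex" where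
    "k = (\<lambda>z. Complex (2 * (Im z - (Re z - 1) * (3 - Re z))) (2 * (Im z - Re z * (2 - Re z))))"
  \<comment> \<open>\<open>k'\<close> solves for \<open>z\<close>: the difference of the two
    coordinates of \<open>k z\<close> is \<open>6 - 4 * Re z\<close>, which gives the real part, and
    the first coordinate then gives the imaginary part.\<close>
  define k' :: "complex \<Rightarrow> complex" where
    "k' = (\<lambda>w. Complex (3/2 - (Re w - Im w) / 4)
                 (Re w / 2 + (1/2 - (Re w - Im w) / 4) * (3/2 + (Re w - Im w) / 4)))"
  define U where "U = k -` ball 0 1"
  have kk': "k (k' w) = w" for w
    by (simp add: k_def k'_def complex_eq_iff field_simps)
  have k'k: "k' (k z) = z" for z
    by (simp add: k_def k'_def complex_eq_iff field_simps)
  have cont: "continuous_on S k" "continuous_on S k'" for S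
    unfolding k_def k'_def Complex_eq by (intro continuous_intros; simp)+
  have "open U" unfolding U_def using cont(1) by (intro open_vimage) auto
  moreover have k0: "k (Complex (3/2) (3/4)) = 0"
    by (simp add: k_def complex_eq_iff)
  moreover have "Complex (3/2) (3/4) \<in> U"
    by (simp add: U_def k0)
  moreover have "homeomorphism U (ball 0 1) k k'"
    using cont kk' k'k by (intro homeomorphismI) (auto simp: U_def)
  \<comment> \<open>On \<open>U\<close> both coordinates have modulus below 1, so
    \<open>6 - 4 * Re z\<close> has modulus below 2. Hence \<open>U\<close> lies above the overlap
    of the two base segments, where membership in an arch is just its equation.\<close>
  moreover have x: "1 \<le> Re z" "Re z \<le> 2" if "z \<in> U" for z
  proof -
    have "\<bar>Re (k z)\<bar> < 1" "\<bar>Im (k z)\<bar> < 1"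
      using that abs_Re_le_cmod[of "k z"] abs_Im_le_cmod[of "k z"] by (auto simp: U_def)
    then show "1 \<le> Re z" "Re z \<le> 2" by (auto simp: k_def abs_if algebra_simps split: if_splits)
  qed
  moreover have "k ` (path_image (arch 1 0 2) \<inter> U) = {w \<in> ball 0 1. Im w = 0}"
  proof
    show "k ` (path_image (arch 1 0 2) \<inter> U) \<subseteq> {w \<in> ball 0 1. Im w = 0}"
      by (auto simp: path_image_arch U_def k_def)
    show "{w \<in> ball 0 1. Im w = 0} \<subseteq> k ` (path_image (arch 1 0 2) \<inter> U)"
    proof
      fix w :: complex assume w: "w \<in> {w \<in> ball 0 1. Im w = 0}"
      then have U: "k' w \<in> U" by (simp add: U_def kk')
      then have "k' w \<in> path_image (arch 1 0 2)"
        using x[OF U] w by (simp add: path_image_arch) (simp add: k'_def field_simps)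
      then show "w \<in> k ` (path_image (arch 1 0 2) \<inter> U)" using U kk' by (metis IntI image_eqI)
    qed
  qed
  moreover have "k ` (path_image (arch 1 1 3) \<inter> U) = {w \<in> ball 0 1. Re w = 0}"
  proof
    show "k ` (path_image (arch 1 1 3) \<inter> U) \<subseteq> {w \<in> ball 0 1. Re w = 0}"
      by (auto simp: path_image_arch U_def k_def)
    show "{w \<in> ball 0 1. Re w = 0} \<subseteq> k ` (path_image (arch 1 1 3) \<inter> U)"
    proof
      fix w :: complex assume w: "w \<in> {w \<in> ball 0 1. Re w = 0}"
      then have U: "k' w \<in> U" by (simp add: U_def kk')
      then have "k' w \<in> path_image (arch 1 1 3)"
        using x[OF U] w by (simp add: path_image_arch) (simp add: k'_def field_simps)
      then show "w \<in> k ` (path_image (arch 1 1 3) \<inter> U)" using U kk' by (metis IntI image_eqI)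
    qed
  qed
  ultimately show ?thesis unfolding cross_at_def by blast
qed

text \<open>Each vertex sits at its own number on the real line and each edge is an arch above the
  line. Positive heights keep arches off all vertices but their ends, and the interleaved end pairs
  of \<open>e\<close> and \<open>f\<close> force these two to cross.\<close>

lemma loopless_graph_has_crossing_drawing:
  fixes G :: "(nat, nat) multigraph"
  assumes ends: "\<And>g. g \<in> edges G \<Longrightarrow> ends G g \<subseteq> verts G \<and> card (ends G g) = 2"
    and e: "ends G e = {0, 2}" and f: "ends G f = {1, 3}"
  shows "\<exists>p \<gamma>. drawing G p \<gamma> \<and> edges_cross G p \<gamma> e f"
proof -
  define p :: "nat \<Rightarrow> complex" where "p = (\<lambda>n. complex_of_real (real n))"
  \<comment> \<open>The heights differ except for \<open>e\<close> and \<open>f\<close>, which are to cross as in \<open>cross_at_arches\<close>.\<close>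
  define h where "h = (\<lambda>g. if g = e \<or> g = f then 1 else real g + 2)"
  define lo where "lo = (\<lambda>g. real (Min (ends G g)))"
  define hi where "hi = (\<lambda>g. real (Max (ends G g)))"
  define \<gamma> where "\<gamma> = (\<lambda>g. arch (h g) (lo g) (hi g))"
  have lohi: "lo g < hi g" "p ` ends G g = {complex_of_real (lo g), complex_of_real (hi g)}"
    if g: "g \<in> edges G" for g
  proof -
    obtain u v where "u < v" "ends G g = {u, v}"
      using ends[OF g] by (metis card_2_iff insert_commute linorder_neqE_nat)
    then show "lo g < hi g" "p ` ends G g = {complex_of_real (lo g), complex_of_real (hi g)}"
      by (auto simp: lo_def hi_def p_def max_def min_def)
  qed
  have lohi_ef: "lo e = 0" "hi e = 2" "lo f = 1" "hi f = 3"
    by (auto simp: lo_def hi_def e f)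
  have hpos: "h g > 0" for g by (simp add: h_def)
  have "drawing G p \<gamma>"
    unfolding drawing_def
  proof (intro conjI ballI impI)
    show "inj_on p (verts G)" by (auto simp: p_def inj_on_def)
  next
    fix g assume g: "g \<in> edges G"
    show "simple_path (\<gamma> g)" using lohi[OF g] by (simp add: \<gamma>_def simple_path_arch)
    show "{pathstart (\<gamma> g), pathfinish (\<gamma> g)} = p ` ends G g"
      using lohi[OF g] by (simp add: \<gamma>_def)
    show "path_image (\<gamma> g) \<inter> p ` verts G = p ` ends G g"
    proof
      show "path_image (\<gamma> g) \<inter> p ` verts G \<subseteq> p ` ends G g"
        using lohi[OF g] hpos[of g] by (auto simp: \<gamma>_def path_image_arch p_def complex_eq_iff)
      show "p ` ends G g \<subseteq> path_image (\<gamma> g) \<inter> p ` verts G"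
      proof
        fix z assume z: "z \<in> p ` ends G g"
        then have "z \<in> path_image (\<gamma> g)"
          using lohi[OF g] by (auto simp: \<gamma>_def path_image_arch)
        then show "z \<in> path_image (\<gamma> g) \<inter> p ` verts G" using z ends[OF g] by blast
      qed
    qed
  next
    fix g g' assume g: "g \<in> edges G" "g' \<in> edges G" "g \<noteq> g'"
    \<comment> \<open>Equal heights occur only for \<open>e\<close> and \<open>f\<close>, whose ends
      add up to 2 and 4, so that the second condition for finite intersection applies.\<close>
    have "h g \<noteq> h g' \<or> {g, g'} = {e, f}" using g(3) by (auto simp: h_def)
    then have "h g \<noteq> h g' \<or> h g \<noteq> 0 \<and> lo g + hi g \<noteq> lo g' + hi g'"
      using hpos[of g] lohi_ef by (auto simp: doubleton_eq_iff)
    then show "finite (path_image (\<gamma> g) \<inter> path_image (\<gamma> g'))"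
      unfolding \<gamma>_def using lohi g by (intro finite_arch_Int_arch) auto
  qed
  moreover have "edges_cross G p \<gamma> e f"
    unfolding edges_cross_def \<gamma>_def lohi_ef h_def
    using cross_at_arches by (intro exI[of _ "Complex (3/2) (3/4)"]) (auto simp: p_def complex_eq_iff)
  ultimately show ?thesis by blast
qed


section \<open>Replacing a crossing by the gadget\<close>

text \<open>A vertex set of the graph after replacement has a trace \<open>S\<close> on
  \<open>G\<close> and a trace \<open>W\<close> on the gadget; agreement on the four identified
  vertices is what lets a pair of traces be glued.\<close>

definition corresponding ::
  "'v \<Rightarrow> 'v \<Rightarrow> 'v \<Rightarrow> 'v \<Rightarrow> 'a \<Rightarrow> 'a \<Rightarrow> 'a \<Rightarrow> 'a \<Rightarrow> 'v set \<Rightarrow> 'a set \<Rightarrow> bool" where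
  "corresponding a' b' c' d' a b c d S W \<longleftrightarrow>
     (a' \<in> S \<longleftrightarrow> a \<in> W) \<and> (b' \<in> S \<longleftrightarrow> b \<in> W) \<and> (c' \<in> S \<longleftrightarrow> c \<in> W) \<and> (d' \<in> S \<longleftrightarrow> d \<in> W)"

lemma finite_induced_edges: "finite_multigraph G \<Longrightarrow> finite (induced_edges G S)"
  by (auto simp: finite_multigraph_def induced_edges_def)

lemma sparse_gadget_replacement_iff:
  assumes G: "finite_multigraph G" "{a', b', c', d'} \<subseteq> verts G" "distinct [a', b', c', d']"
    and \<Gamma>: "finite_multigraph \<Gamma>" "{a, b, c, d} \<subseteq> verts \<Gamma>"
    and rep: "gadget_replacement G e f a' b' c' d' \<Gamma> a b c d H"
  shows "finite_multigraph H \<and> (sparse k l H \<longleftrightarrow>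
    (\<forall>S\<subseteq>verts G. \<forall>W\<subseteq>verts \<Gamma>. corresponding a' b' c' d' a b c d S W \<longrightarrow>
       2 \<le> card S + card (W - {a, b, c, d}) \<longrightarrow>
       int (card (induced_edges G S - {e, f}) + card (induced_edges \<Gamma> W))
         \<le> k * int (card S + card (W - {a, b, c, d})) - l))"
proof -
  obtain \<phi> \<psi> where \<phi>: "inj_on \<phi> (verts \<Gamma>)" and \<psi>: "inj_on \<psi> (edges \<Gamma>)"
    and abcd: "\<phi> a = a'" "\<phi> b = b'" "\<phi> c = c'" "\<phi> d = d'"
    and fresh: "\<phi> ` (verts \<Gamma> - {a, b, c, d}) \<inter> verts G = {}" "\<psi> ` edges \<Gamma> \<inter> edges G = {}"
    and H: "verts H = verts G \<union> \<phi> ` verts \<Gamma>" "edges H = (edges G - {e, f}) \<union> \<psi> ` edges \<Gamma>"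
    and endsH: "\<forall>g\<in>edges G - {e, f}. ends H g = ends G g" "\<forall>g\<in>edges \<Gamma>. ends H (\<psi> g) = \<phi> ` ends \<Gamma> g"
    using rep unfolding gadget_replacement_def by - (elim exE conjE, rule that)
  have fin: "finite (verts G)" "finite (edges G)" "finite (verts \<Gamma>)" "finite (edges \<Gamma>)"
    using G(1) \<Gamma>(1) by (auto simp: finite_multigraph_def)
  have endsG: "ends G g \<subseteq> verts G \<and> card (ends G g) \<in> {1, 2}" if "g \<in> edges G" for g
    using G(1) that by (auto simp: finite_multigraph_def)
  have ends\<Gamma>: "ends \<Gamma> g \<subseteq> verts \<Gamma> \<and> card (ends \<Gamma> g) \<in> {1, 2}" if "g \<in> edges \<Gamma>" for g
    using \<Gamma>(1) that by (auto simp: finite_multigraph_def)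
  have "finite_multigraph H"
    unfolding finite_multigraph_def
  proof (intro conjI ballI)
    show "finite (verts H)" "finite (edges H)" using fin by (auto simp: H)
    fix g assume "g \<in> edges H"
    then consider "g \<in> edges G - {e, f}" | g0 where "g0 \<in> edges \<Gamma>" "g = \<psi> g0" by (auto simp: H)
    then have "ends H g \<subseteq> verts H \<and> card (ends H g) \<in> {1, 2}"
    proof cases
      case 1 then show ?thesis using endsG H endsH(1) by auto
    next
      case 2
      then have "card (\<phi> ` ends \<Gamma> g0) = card (ends \<Gamma> g0)"
        using \<phi> ends\<Gamma> by (metis card_image inj_on_subset)
      then show ?thesis using 2 ends\<Gamma>[OF 2(1)] H(1) endsH(2) by auto
    qed
    then show "ends H g \<subseteq> verts H" "card (ends H g) \<in> {1, 2}" by auto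
  qed
  have key: "card (S \<union> \<phi> ` W) = card S + card (W - {a, b, c, d}) \<and>
      card (induced_edges H (S \<union> \<phi> ` W)) = card (induced_edges G S - {e, f}) + card (induced_edges \<Gamma> W)"
    if S: "S \<subseteq> verts G" and W: "W \<subseteq> verts \<Gamma>" and m: "corresponding a' b' c' d' a b c d S W" for S W
  proof
    have "S \<union> \<phi> ` W = S \<union> \<phi> ` (W - {a, b, c, d})"
      using m abcd by (auto simp: corresponding_def)
    moreover have "S \<inter> \<phi> ` (W - {a, b, c, d}) = {}" using fresh(1) S W by blast
    moreover have "card (\<phi> ` (W - {a, b, c, d})) = card (W - {a, b, c, d})"
      using \<phi> W by (intro card_image inj_on_subset[OF \<phi>]) auto
    ultimately show "card (S \<union> \<phi> ` W) = card S + card (W - {a, b, c, d})"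
      using fin S W by (simp add: card_Un_disjoint finite_subset)
    \<comment> \<open>Facts \<open>1\<close> and \<open>2\<close> say that the glued set has traces
      exactly \<open>S\<close> and \<open>W\<close>, so it induces no edges beyond those of its two
      parts.\<close>
    have 1: "(S \<union> \<phi> ` W) \<inter> verts G = S"
    proof -
      have "\<phi> x \<in> S" if "x \<in> W" "\<phi> x \<in> verts G" for x
      proof -
        have "x \<in> {a, b, c, d}" using that W fresh(1) by blast
        then show ?thesis using m abcd that(1) by (auto simp: corresponding_def)
      qed
      then show ?thesis using S by auto
    qed
    have 2: "x \<in> W" if "x \<in> verts \<Gamma>" "\<phi> x \<in> S \<union> \<phi> ` W" for x
    proof (cases "\<phi> x \<in> S")
      case True
      then have "x \<in> {a, b, c, d}" using that S fresh(1) by blast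
      then show ?thesis using m abcd True by (auto simp: corresponding_def)
    next
      case False
      then show ?thesis using that W \<phi> by (auto dest: inj_onD)
    qed
    have "induced_edges H (S \<union> \<phi> ` W) = (induced_edges G S - {e, f}) \<union> \<psi> ` induced_edges \<Gamma> W"
    proof (rule set_eqI)
      fix g
      have "ends H g \<subseteq> S \<union> \<phi> ` W \<longleftrightarrow> ends G g \<subseteq> S" if "g \<in> edges G - {e, f}"
        using 1 endsG[of g] bspec[OF endsH(1) that] that by auto
      moreover have "ends H (\<psi> g0) \<subseteq> S \<union> \<phi> ` W \<longleftrightarrow> ends \<Gamma> g0 \<subseteq> W" if "g0 \<in> edges \<Gamma>" for g0
      proof
        assume "ends H (\<psi> g0) \<subseteq> S \<union> \<phi> ` W"
        then show "ends \<Gamma> g0 \<subseteq> W" using 2 bspec[OF endsH(2) that] ends\<Gamma>[OF that] by blast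
      next
        assume "ends \<Gamma> g0 \<subseteq> W"
        then show "ends H (\<psi> g0) \<subseteq> S \<union> \<phi> ` W" using bspec[OF endsH(2) that] by blast
      qed
      ultimately show "g \<in> induced_edges H (S \<union> \<phi> ` W) \<longleftrightarrow>
          g \<in> (induced_edges G S - {e, f}) \<union> \<psi> ` induced_edges \<Gamma> W"
        unfolding induced_edges_def H(2) by auto
    qed
    moreover have "(induced_edges G S - {e, f}) \<inter> \<psi> ` induced_edges \<Gamma> W = {}"
      using fresh(2) by (auto simp: induced_edges_def)
    moreover have "card (\<psi> ` induced_edges \<Gamma> W) = card (induced_edges \<Gamma> W)"
      by (intro card_image inj_on_subset[OF \<psi>]) (auto simp: induced_edges_def)
    ultimately show "card (induced_edges H (S \<union> \<phi> ` W))
        = card (induced_edges G S - {e, f}) + card (induced_edges \<Gamma> W)"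
      using G(1) \<Gamma>(1) by (simp add: card_Un_disjoint finite_induced_edges)
  qed
  have repr: "\<exists>S\<subseteq>verts G. \<exists>W\<subseteq>verts \<Gamma>. corresponding a' b' c' d' a b c d S W \<and> U = S \<union> \<phi> ` W"
    if "U \<subseteq> verts H" for U
  proof -
    have "corresponding a' b' c' d' a b c d (U \<inter> verts G) {x \<in> verts \<Gamma>. \<phi> x \<in> U}"
      using G(2) \<Gamma>(2) abcd by (auto simp: corresponding_def)
    moreover have "U = (U \<inter> verts G) \<union> \<phi> ` {x \<in> verts \<Gamma>. \<phi> x \<in> U}"
      using that H(1) by auto
    ultimately show ?thesis
      by (intro exI[of _ "U \<inter> verts G"] exI[of _ "{x \<in> verts \<Gamma>. \<phi> x \<in> U}"] conjI) auto
  qed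
  have sub: "S \<union> \<phi> ` W \<subseteq> verts H" if "S \<subseteq> verts G" "W \<subseteq> verts \<Gamma>" for S W
    using that H(1) by auto
  have "sparse k l H \<longleftrightarrow>
    (\<forall>S\<subseteq>verts G. \<forall>W\<subseteq>verts \<Gamma>. corresponding a' b' c' d' a b c d S W \<longrightarrow> 2 \<le> card (S \<union> \<phi> ` W) \<longrightarrow>
       int (card (induced_edges H (S \<union> \<phi> ` W))) \<le> k * int (card (S \<union> \<phi> ` W)) - l)"
    unfolding sparse_def
  proof (intro iffI allI impI)
    fix U assume *: "\<forall>S\<subseteq>verts G. \<forall>W\<subseteq>verts \<Gamma>. corresponding a' b' c' d' a b c d S W \<longrightarrow>
        2 \<le> card (S \<union> \<phi> ` W) \<longrightarrow>
        int (card (induced_edges H (S \<union> \<phi> ` W))) \<le> k * int (card (S \<union> \<phi> ` W)) - l"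
      and U: "U \<subseteq> verts H" "2 \<le> card U"
    from repr[OF U(1)] obtain S W where SW: "S \<subseteq> verts G" "W \<subseteq> verts \<Gamma>"
      "corresponding a' b' c' d' a b c d S W" "U = S \<union> \<phi> ` W"
      by (elim exE conjE)
    then show "int (card (induced_edges H U)) \<le> k * int (card U) - l"
      using * U(2) by simp
  qed (use sub in simp)
  then show ?thesis using \<open>finite_multigraph H\<close> key by simp
qed

lemma gadget_replacement_exists:
  fixes G :: "(nat, nat) multigraph"
  assumes G: "finite_multigraph G" "{a', b', c', d'} \<subseteq> verts G" "distinct [a', b', c', d']"
    and \<Gamma>: "finite_multigraph \<Gamma>" "distinct [a, b, c, d]"
  shows "\<exists>H. gadget_replacement G e f a' b' c' d' \<Gamma> a b c d H"
proof -
  have fin: "finite (verts G)" "finite (edges G)" "finite (verts \<Gamma>)" "finite (edges \<Gamma>)"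
    using G(1) \<Gamma>(1) by (auto simp: finite_multigraph_def)
  obtain i :: "'a \<Rightarrow> nat" where i: "inj_on i (verts \<Gamma>)"
    using finite_imp_inj_to_nat_seg[OF fin(3)] by blast
  obtain j :: "'b \<Rightarrow> nat" where j: "inj_on j (edges \<Gamma>)"
    using finite_imp_inj_to_nat_seg[OF fin(4)] by blast
  obtain m where m: "\<And>v. v \<in> verts G \<Longrightarrow> v < m"
    using finite_nat_set_iff_bounded[of "verts G"] fin by auto
  obtain n where n: "\<And>g. g \<in> edges G \<Longrightarrow> g < n"
    using finite_nat_set_iff_bounded[of "edges G"] fin by auto
  \<comment> \<open>Shifting by \<open>m\<close> and \<open>n\<close> moves the new vertices and
    edges beyond everything in \<open>G\<close>; the updates then place the terminals. Being at
    least \<open>m\<close> thus distinguishes the images of the other vertices from those of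
    terminals.\<close>
  define \<phi> where "\<phi> = (\<lambda>x. i x + m)(a := a', b := b', c := c', d := d')"
  define \<psi> where "\<psi> = (\<lambda>g. j g + n)"
  define H where "H = \<lparr>verts = verts G \<union> \<phi> ` verts \<Gamma>, edges = (edges G - {e, f}) \<union> \<psi> ` edges \<Gamma>,
    ends = (\<lambda>g. if g \<in> edges G then ends G g else \<phi> ` ends \<Gamma> (inv_into (edges \<Gamma>) \<psi> g))\<rparr>"
  have lt: "a' < m" "b' < m" "c' < m" "d' < m" using G(2) m by auto
  have abcd: "\<phi> a = a'" "\<phi> b = b'" "\<phi> c = c'" "\<phi> d = d'" using \<Gamma>(2) by (auto simp: \<phi>_def)
  have other: "\<phi> x = i x + m" if "x \<notin> {a, b, c, d}" for x using that by (simp add: \<phi>_def)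
  have "inj_on \<phi> (verts \<Gamma>)"
  proof (rule inj_onI)
    fix x y assume xy: "x \<in> verts \<Gamma>" "y \<in> verts \<Gamma>" "\<phi> x = \<phi> y"
    have "\<phi> z \<ge> m \<longleftrightarrow> z \<notin> {a, b, c, d}" for z
      using other[of z] lt abcd by auto
    then have "x \<in> {a, b, c, d} \<longleftrightarrow> y \<in> {a, b, c, d}" using xy(3) by metis
    then consider "x \<in> {a, b, c, d}" "y \<in> {a, b, c, d}" | "x \<notin> {a, b, c, d}" "y \<notin> {a, b, c, d}" by blast
    then show "x = y"
    proof cases
      case 1
      then show ?thesis using xy(3) abcd G(3) by auto
    next
      case 2
      then show ?thesis using xy other[of x] other[of y] i by (auto dest: inj_onD)
    qed
  qed
  moreover have inj: "inj_on \<psi> (edges \<Gamma>)" using j by (auto simp: \<psi>_def inj_on_def)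
  moreover have "\<phi> ` (verts \<Gamma> - {a, b, c, d}) \<inter> verts G = {}" using other m by fastforce
  moreover have fresh: "\<psi> ` edges \<Gamma> \<inter> edges G = {}" using n by (fastforce simp: \<psi>_def)
  moreover have "\<forall>g\<in>edges \<Gamma>. ends H (\<psi> g) = \<phi> ` ends \<Gamma> g"
    using fresh inj by (auto simp: H_def)
  moreover have "verts H = verts G \<union> \<phi> ` verts \<Gamma>" "edges H = (edges G - {e, f}) \<union> \<psi> ` edges \<Gamma>"
    "\<forall>g\<in>edges G - {e, f}. ends H g = ends G g" by (auto simp: H_def)
  ultimately show ?thesis
    unfolding gadget_replacement_def using abcd
    by (intro exI[of _ H] exI[of _ \<phi>] exI[of _ \<psi>] conjI)
qed

section \<open>Test graphs with prescribed edge multiplicities\<close>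

definition pairs :: "'a set \<Rightarrow> 'a set set" where
  "pairs S = {s. s \<subseteq> S \<and> card s = 2}"

lemma finite_pairs: "finite S \<Longrightarrow> finite (pairs S)"
  by (rule finite_subset[of _ "Pow S"]) (auto simp: pairs_def)

text \<open>
  The terminals \<open>a, b, c, d\<close> become \<open>0, 2, 1, 3\<close>, so that the drawing with vertices on the real line
  makes \<open>ab\<close> and \<open>cd\<close> cross. The multiplicities \<open>\<mu>\<close> do not count the two crossing edges.
\<close>

lemma multigraph_of_multiplicities:
  fixes V :: "nat set" and \<mu> :: "nat set \<Rightarrow> nat"
  assumes V: "finite V" "{0, 1, 2, 3} \<subseteq> V"
  obtains G :: "(nat, nat) multigraph" and e f where
    "verts G = V" "finite_multigraph G" "\<And>g. g \<in> edges G \<Longrightarrow> ends G g \<subseteq> verts G \<and> card (ends G g) = 2"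
    "e \<in> edges G" "f \<in> edges G" "ends G e = {0, 2}" "ends G f = {1, 3}"
    "\<And>S. S \<subseteq> V \<Longrightarrow> card (induced_edges G S - {e, f}) = sum \<mu> (pairs S)"
    "\<And>S. S \<subseteq> V \<Longrightarrow>
       card (induced_edges G S) = sum \<mu> (pairs S) + of_bool ({0, 2} \<subseteq> S) + of_bool ({1, 3} \<subseteq> S)"
proof -
  \<comment> \<open>An edge is the number coding its pair of ends together with an index among its
    parallel copies, so its ends can be decoded from its name.\<close>
  define code :: "nat set \<times> nat \<Rightarrow> nat" where "code = (\<lambda>(s, i). prod_encode (set_encode s, i))"
  define dec :: "nat \<Rightarrow> nat set" where "dec = (\<lambda>n. set_decode (fst (prod_decode n)))"
  have dec: "dec (code (s, i)) = s" if "finite s" for s i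
    using that by (simp add: dec_def code_def)
  have finp: "finite s" if "s \<in> pairs S" for s and S :: "nat set"
    using that by (auto simp: pairs_def intro: card_ge_0_finite)
  have inj: "inj_on code (Sigma (pairs V) A)" for A
    by (rule inj_onI) (auto simp: code_def set_encode_eq dest!: finp)
  \<comment> \<open>\<open>\<mu>'\<close> also counts the crossing edges. Indices start at 0, so
    \<open>e\<close> and \<open>f\<close> are the one additional copy on \<open>{0, 2}\<close> and
    on \<open>{1, 3}\<close>.\<close>
  define \<mu>' where "\<mu>' = (\<lambda>s. \<mu> s + of_bool (s = {0, 2}) + of_bool (s = {1, 3}))"
  define e where "e = code ({0, 2}, \<mu> {0, 2})"
  define f where "f = code ({1, 3}, \<mu> {1, 3})"
  define G where "G = \<lparr>verts = V, edges = code ` Sigma (pairs V) (\<lambda>s. {..<\<mu>' s}), ends = dec\<rparr>"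
  have ef: "{0, 2} \<in> pairs V" "{1, 3} \<in> pairs V" using V(2) by (auto simp: pairs_def)
  have neq: "{0, 2} \<noteq> {1, 3::nat}" by (simp add: doubleton_eq_iff)
  have pmono: "pairs S \<subseteq> pairs V" if "S \<subseteq> V" for S using that by (auto simp: pairs_def)
  have ind: "induced_edges G S = code ` Sigma (pairs S) (\<lambda>s. {..<\<mu>' s})" if "S \<subseteq> V" for S
  proof -
    have "induced_edges G S = code ` {x \<in> Sigma (pairs V) (\<lambda>s. {..<\<mu>' s}). fst x \<subseteq> S}"
      unfolding induced_edges_def G_def using dec[OF finp[of _ V]] by auto
    also have "{x \<in> Sigma (pairs V) (\<lambda>s. {..<\<mu>' s}). fst x \<subseteq> S} = Sigma (pairs S) (\<lambda>s. {..<\<mu>' s})"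
      using that by (auto simp: pairs_def)
    finally show ?thesis .
  qed
  have cardS: "card (code ` Sigma (pairs S) (\<lambda>s. {..<\<nu> s})) = sum \<nu> (pairs S)" if "S \<subseteq> V" for S \<nu>
  proof -
    have "Sigma (pairs S) (\<lambda>s. {..<\<nu> s}) \<subseteq> Sigma (pairs V) (\<lambda>s. {..<\<nu> s})"
      using pmono[OF that] by blast
    then have "card (code ` Sigma (pairs S) (\<lambda>s. {..<\<nu> s})) = card (Sigma (pairs S) (\<lambda>s. {..<\<nu> s}))"
      by (intro card_image inj_on_subset[OF inj])
    then show ?thesis
      using finite_pairs[OF finite_subset[OF that V(1)]] by simp
  qed
  have diff: "Sigma (pairs S) (\<lambda>s. {..<\<mu>' s}) - {({0, 2}, \<mu> {0, 2}), ({1, 3}, \<mu> {1, 3})}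
      = Sigma (pairs S) (\<lambda>s. {..<\<mu> s})" for S
  proof -
    have "Sigma B (\<lambda>s. {..<\<mu> s + of_bool (s = P) + of_bool (s = Q)}) - {(P, \<mu> P), (Q, \<mu> Q)}
        = Sigma B (\<lambda>s. {..<\<mu> s})" if "P \<noteq> Q" for B P Q
      using that by (auto simp: of_bool_def less_Suc_eq split: if_splits)
    from this[OF neq] show ?thesis unfolding \<mu>'_def .
  qed
  have "induced_edges G S - {e, f} = code ` Sigma (pairs S) (\<lambda>s. {..<\<mu> s})" if "S \<subseteq> V" for S
  proof -
    have sub: "Sigma (pairs S) (\<lambda>s. {..<\<mu>' s}) \<union> {({0, 2}, \<mu> {0, 2}), ({1, 3}, \<mu> {1, 3})}
      \<subseteq> Sigma (pairs V) (\<lambda>s. {..\<mu>' s})"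
      using pmono[OF that] ef by (auto simp: \<mu>'_def)
    have "induced_edges G S - {e, f} =
       code ` Sigma (pairs S) (\<lambda>s. {..<\<mu>' s}) - code ` {({0, 2}, \<mu> {0, 2}), ({1, 3}, \<mu> {1, 3})}"
      unfolding ind[OF that] e_def f_def by simp
    also have "\<dots> = code ` (Sigma (pairs S) (\<lambda>s. {..<\<mu>' s}) - {({0, 2}, \<mu> {0, 2}), ({1, 3}, \<mu> {1, 3})})"
      by (rule inj_on_image_set_diff[OF inj, symmetric]) (use sub in auto)
    finally show ?thesis unfolding diff .
  qed
  then have c1: "card (induced_edges G S - {e, f}) = sum \<mu> (pairs S)" if "S \<subseteq> V" for S
    using that cardS by simp
  have c2: "card (induced_edges G S) = sum \<mu> (pairs S) + of_bool ({0, 2} \<subseteq> S) + of_bool ({1, 3} \<subseteq> S)"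
    if "S \<subseteq> V" for S
  proof -
    have "finite (pairs S)" using finite_pairs[OF finite_subset[OF that V(1)]] .
    moreover have "{0, 2} \<in> pairs S \<longleftrightarrow> {0, 2} \<subseteq> S" "{1, 3} \<in> pairs S \<longleftrightarrow> {1, 3} \<subseteq> S"
      by (auto simp: pairs_def)
    ultimately show ?thesis
      unfolding ind[OF that] cardS[OF that] \<mu>'_def sum.distrib by (simp add: of_bool_def)
  qed
  have ends: "ends G g \<subseteq> verts G \<and> card (ends G g) = 2" if "g \<in> edges G" for g
    using that by (auto simp: G_def dec finp) (auto simp: pairs_def)
  have "finite_multigraph G"
    unfolding finite_multigraph_def
    using ends V finite_pairs[OF V(1)] by (auto simp: G_def)
  moreover have "e \<in> edges G" "f \<in> edges G" "ends G e = {0, 2}" "ends G f = {1, 3}"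
    unfolding e_def f_def using ef by (auto simp: G_def dec \<mu>'_def)
  moreover have "verts G = V" by (simp add: G_def)
  ultimately show thesis using that ends c1 c2 by blast
qed

text \<open>The left side is sparsity of a test graph including its crossing edges, the right side
  sparsity after replacement. All counting facts about the gadget come from suitable choices of
  \<open>V\<close> and \<open>\<mu>\<close> here.\<close>

lemma gadget_sparse_iff:
  fixes V :: "nat set" and \<mu> :: "nat set \<Rightarrow> nat"
  assumes gad: "planarizing_gadget (sparse_graphs k l) \<Gamma> a b c d"
    and V: "finite V" "{0, 1, 2, 3} \<subseteq> V"
  shows "(\<forall>S\<subseteq>V. 2 \<le> card S \<longrightarrow>
       int (sum \<mu> (pairs S) + of_bool ({0, 2} \<subseteq> S) + of_bool ({1, 3} \<subseteq> S)) \<le> k * int (card S) - l) \<longleftrightarrow>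
    (\<forall>S\<subseteq>V. \<forall>W\<subseteq>verts \<Gamma>. corresponding 0 2 1 3 a b c d S W \<longrightarrow>
       2 \<le> card S + card (W - {a, b, c, d}) \<longrightarrow>
       int (sum \<mu> (pairs S) + card (induced_edges \<Gamma> W))
         \<le> k * int (card S + card (W - {a, b, c, d})) - l)"
proof -
  obtain G :: "(nat, nat) multigraph" and e f where G: "verts G = V" "finite_multigraph G"
    "\<And>g. g \<in> edges G \<Longrightarrow> ends G g \<subseteq> verts G \<and> card (ends G g) = 2"
    "e \<in> edges G" "f \<in> edges G" "ends G e = {0, 2}" "ends G f = {1, 3}"
    and c1: "\<And>S. S \<subseteq> V \<Longrightarrow> card (induced_edges G S - {e, f}) = sum \<mu> (pairs S)"
    and c2: "\<And>S. S \<subseteq> V \<Longrightarrow>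
       card (induced_edges G S) = sum \<mu> (pairs S) + of_bool ({0, 2} \<subseteq> S) + of_bool ({1, 3} \<subseteq> S)"
    using multigraph_of_multiplicities[OF V, of \<mu>] by blast
  obtain p \<gamma> where draw: "drawing G p \<gamma>" "edges_cross G p \<gamma> e f"
    using loopless_graph_has_crossing_drawing[OF G(3) G(6,7)] by blast
  have \<Gamma>: "finite_multigraph \<Gamma>" "{a, b, c, d} \<subseteq> verts \<Gamma>" "distinct [a, b, c, d]"
    using gad unfolding planarizing_gadget_def by blast+
  have d: "distinct [0, 2, 1, 3::nat]" and sub: "{0, 2, 1, 3} \<subseteq> verts G" using V G(1) by auto
  obtain H where H: "gadget_replacement G e f 0 2 1 3 \<Gamma> a b c d H"
    using gadget_replacement_exists[OF G(2) sub d \<Gamma>(1,3)] by blast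
  have "G \<in> sparse_graphs k l \<longleftrightarrow> H \<in> sparse_graphs k l"
    using gad G(2,4-7) draw d H unfolding planarizing_gadget_def by blast
  then have iff: "sparse k l G \<longleftrightarrow> sparse k l H"
    using G(2) sparse_gadget_replacement_iff[OF G(2) sub d \<Gamma>(1,2) H]
    by (simp add: sparse_graphs_def)
  have "sparse k l G \<longleftrightarrow> (\<forall>S\<subseteq>V. 2 \<le> card S \<longrightarrow>
       int (sum \<mu> (pairs S) + of_bool ({0, 2} \<subseteq> S) + of_bool ({1, 3} \<subseteq> S)) \<le> k * int (card S) - l)"
    unfolding sparse_def G(1) using c2 by auto
  moreover have "sparse k l H \<longleftrightarrow>
    (\<forall>S\<subseteq>V. \<forall>W\<subseteq>verts \<Gamma>. corresponding 0 2 1 3 a b c d S W \<longrightarrow>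
       2 \<le> card S + card (W - {a, b, c, d}) \<longrightarrow>
       int (sum \<mu> (pairs S) + card (induced_edges \<Gamma> W))
         \<le> k * int (card S + card (W - {a, b, c, d})) - l)"
    using sparse_gadget_replacement_iff[OF G(2) sub d \<Gamma>(1,2) H, of k l] c1 unfolding G(1) by auto
  ultimately show ?thesis using iff by blast
qed


section \<open>Edge counts in a gadget\<close>

lemma sum_pairs_single:
  assumes "finite S" "u \<noteq> w"
  shows "(\<Sum>s\<in>pairs S. if s = {u, w} then m else 0 :: nat) = (if {u, w} \<subseteq> S then m else 0)"
  using assms finite_pairs[OF assms(1)] by (auto simp: pairs_def)

lemma subset_doubletons_card:
  fixes S :: "nat set"
  assumes "finite S"
  shows "{0, 2} \<subseteq> S \<Longrightarrow> {1, 3} \<subseteq> S \<Longrightarrow> 4 \<le> card S"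
    and "{u, w} \<subseteq> S \<Longrightarrow> x \<in> S \<Longrightarrow> u \<noteq> w \<Longrightarrow> x \<noteq> u \<Longrightarrow> x \<noteq> w \<Longrightarrow> 3 \<le> card S"
    and "{0, 2} \<subseteq> S \<Longrightarrow> {1, 3} \<subseteq> S \<Longrightarrow> 4 \<in> S \<Longrightarrow> 5 \<le> card S"
  using card_mono[OF assms, of "{0, 2, 1, 3}"] card_mono[OF assms, of "{u, w, x}"]
    card_mono[OF assms, of "{0, 2, 1, 3, 4}"] by auto

text \<open>The test graph is sparse, so its replacement is too. Vertex 4 is no terminal, so
  \<open>S = {u, 4}\<close> is a tight set with one terminal and leaves the gadget no slack. Sets
  \<open>S\<close> without 4 are kept in the statement as they serve to locate violations in another
  test graph.\<close>

lemma gadget_bound_one_terminal: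
  fixes k l :: int and u :: nat
  assumes kl: "k \<ge> 2" "0 \<le> l" "l \<le> 2 * k - 1"
    and gad: "planarizing_gadget (sparse_graphs k l) \<Gamma> a b c d"
    and u: "u \<in> {0, 1, 2, 3}" and S: "S \<subseteq> {0, 1, 2, 3, 4}" and W: "W \<subseteq> verts \<Gamma>"
    and m: "corresponding 0 2 1 3 a b c d S W" "2 \<le> card S + card (W - {a, b, c, d})"
  shows "int ((if {u, 4} \<subseteq> S then nat (2 * k - l) else 0) + card (induced_edges \<Gamma> W))
         \<le> k * int (card S + card (W - {a, b, c, d})) - l"
proof -
  \<comment> \<open>The parallel edges make \<open>{u, 4}\<close> tight.\<close>
  define \<mu> where "\<mu> = (\<lambda>s. if s = {u, 4} then nat (2 * k - l) else 0)"
  have u4: "u \<noteq> 4" using u by auto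
  have "int (sum \<mu> (pairs S') + of_bool ({0, 2} \<subseteq> S') + of_bool ({1, 3} \<subseteq> S')) \<le> k * int (card S') - l"
    if S': "S' \<subseteq> {0, 1, 2, 3, 4}" "2 \<le> card S'" for S'
  proof -
    have fin: "finite S'" using S'(1) finite_subset by blast
    \<comment> \<open>Every vertex beyond two raises the bound by \<open>k \<ge> 2\<close>, which
      pays for the crossing edges: beside the tight pair, one of them needs a third vertex and both
      need five vertices.\<close>
    have "2 * (int (card S') - 2) \<le> k * (int (card S') - 2)"
      using kl S'(2) by (intro mult_right_mono) auto
    then have n: "k * int (card S') - l \<ge> 2 * k - l + 2 * (int (card S') - 2)"
      by (simp add: algebra_simps)
    have u02: "3 \<le> card S'" if "{u, 4} \<subseteq> S'" "{0, 2} \<subseteq> S' \<or> {1, 3} \<subseteq> S'"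
      using that subset_doubletons_card(2)[OF fin, of 0 2 4] subset_doubletons_card(2)[OF fin, of 1 3 4]
      by auto
    show ?thesis
      unfolding \<mu>_def sum_pairs_single[OF fin u4]
      using n u02 kl S'(2) subset_doubletons_card(1,3)[OF fin]
      by (cases "{u, 4} \<subseteq> S'"; cases "{0, 2} \<subseteq> S'"; cases "{1, 3} \<subseteq> S'") auto
  qed
  then have "int (sum \<mu> (pairs S) + card (induced_edges \<Gamma> W))
         \<le> k * int (card S + card (W - {a, b, c, d})) - l"
    using gadget_sparse_iff[OF gad, of "{0, 1, 2, 3, 4}" \<mu>] S W m by auto
  then show ?thesis
    unfolding \<mu>_def using sum_pairs_single[OF _ u4] finite_subset[OF S] by simp
qed

lemma twice_choose_two: "2 * int (m choose 2) = int m * (int m - 1)"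
proof -
  have "2 * (m choose 2) = m * (m - 1)"
    using dvd_mult_div_cancel[of 2 "m * (m - 1)"] by (cases m) (simp_all add: choose_two)
  then have "2 * int (m choose 2) = int (m * (m - 1))" by (simp flip: of_nat_mult)
  then show ?thesis by (cases m) (simp_all add: algebra_simps)
qed

text \<open>Twice the difference of the sides is \<open>(m - 2) * (2 * K - 1 - m)\<close>.\<close>

lemma choose_two_bound:
  fixes m K :: nat
  assumes "2 \<le> m" "m \<le> 2 * K - 1"
  shows "(m choose 2) + (2 * K - 1) \<le> K * m"
proof -
  have "0 \<le> (int m - 2) * (2 * int K - 1 - int m)" using assms by (intro mult_nonneg_nonneg) auto
  moreover have "2 * int (m choose 2) = int m * (int m - 1)" by (rule twice_choose_two)
  ultimately have "int ((m choose 2) + (2 * K - 1)) \<le> int (K * m)"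
    using assms by (simp add: algebra_simps of_nat_diff)
  then show ?thesis by linarith
qed

lemma card_pairs: "finite A \<Longrightarrow> card (pairs A) = card A choose 2"
  unfolding pairs_def by (rule n_subsets)

text \<open>The whole test graph is tight with its two crossing edges included. Deleting them frees
  exactly two edges, which is the slack left to the gadget.\<close>

lemma gadget_bound_all_terminals:
  fixes k l :: int
  assumes kl: "k \<ge> 2" "0 \<le> l" "l \<le> 2 * k - 1"
    and gad: "planarizing_gadget (sparse_graphs k l) \<Gamma> a b c d"
    and W: "W \<subseteq> verts \<Gamma>" "{a, b, c, d} \<subseteq> W"
  shows "int (card (induced_edges \<Gamma> W)) \<le> k * int (card (W - {a, b, c, d})) + 2"
proof -
  \<comment> \<open>The clique on \<open>2k - 1\<close> vertices is \<open>(k, 2k - 1)\<close>-tight, and remains so after adding a vertex of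
    degree \<open>k\<close>; then \<open>2k - 1 - l\<close> further parallel edges make it \<open>(k, l)\<close>-tight.\<close>
  define K L where "K = nat k" and "L = nat l"
  have KL: "k = int K" "l = int L" "2 \<le> K" "L \<le> 2 * K - 1" using kl by (auto simp: K_def L_def)
  define V where "V = {..<2 * K}"
  define A where "A = V - {3}"
  have A: "finite A" "card A = 2 * K - 1" "{0, 1, 2} \<subseteq> A" "3 \<notin> A"
    and V: "finite V" "{0, 1, 2, 3} \<subseteq> V" "V = insert 3 A" "card V = 2 * K"
    using KL(3) by (auto simp: A_def V_def)
  \<comment> \<open>\<open>N\<close> holds the neighbours of 3 other than 1; the crossing edge
    \<open>{1, 3}\<close> completes its degree to \<open>K\<close>.\<close>
  have "K - 1 \<le> card (A - {1})" using A by auto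
  then obtain N where N: "N \<subseteq> A - {1}" "card N = K - 1" "finite N"
    by (rule obtain_subset_with_card_n)
  have "1 \<notin> N" using N(1) by blast
  \<comment> \<open>The first summand omits the clique edge \<open>{0, 2}\<close>, which the
    crossing edge supplies. The last one places the further parallel edges on that same
    pair.\<close>
  define \<mu> :: "nat set \<Rightarrow> nat" where "\<mu> = (\<lambda>s. of_bool (s \<in> pairs A - {{0, 2}}) + of_bool (s \<in> (\<lambda>v. {3, v}) ` N)
      + (if s = {0, 2} then 2 * K - 1 - L else 0))"
  have sum\<mu>: "sum \<mu> (pairs S) + of_bool ({0, 2} \<subseteq> S) =
      (card (S \<inter> A) choose 2) + (if 3 \<in> S then card (N \<inter> S) else 0) + (if {0, 2} \<subseteq> S then 2 * K - 1 - L else 0)"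
    if "S \<subseteq> V" for S
  proof -
    have fin: "finite S" "finite (pairs S)" using that V(1) finite_subset finite_pairs by blast+
    have pSA: "{0, 2} \<in> pairs (S \<inter> A) \<longleftrightarrow> {0, 2} \<subseteq> S" using A(3) by (auto simp: pairs_def)
    have "pairs S \<inter> (pairs A - {{0, 2}}) = pairs (S \<inter> A) - {{0, 2}}" by (auto simp: pairs_def)
    then have 1: "(\<Sum>s\<in>pairs S. of_bool (s \<in> pairs A - {{0, 2}})) + of_bool ({0, 2} \<subseteq> S) = card (S \<inter> A) choose 2"
      using fin A(1) pSA card_pairs[of "S \<inter> A"] finite_pairs[of "S \<inter> A"]
        card_Suc_Diff1[of "pairs (S \<inter> A)" "{0, 2}"]
      by (auto simp: of_bool_def sum.If_cases Int_def)
    have "pairs S \<inter> (\<lambda>v. {3, v}) ` N = (if 3 \<in> S then (\<lambda>v. {3, v}) ` (N \<inter> S) else {})"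
      using N(1) A(4) by (auto simp: pairs_def card_insert_if)
    moreover have "card ((\<lambda>v. {3, v}) ` (N \<inter> S)) = card (N \<inter> S)"
      by (intro card_image inj_onI) (auto simp: doubleton_eq_iff)
    ultimately have 2: "(\<Sum>s\<in>pairs S. of_bool (s \<in> (\<lambda>v. {3, v}) ` N)) = (if 3 \<in> S then card (N \<inter> S) else 0)"
      using fin by (simp add: of_bool_def sum.If_cases Int_def)
    show ?thesis
      unfolding \<mu>_def sum.distrib using 1 2 sum_pairs_single[OF fin(1), of 0 2] by simp
  qed
  have "int (sum \<mu> (pairs S) + of_bool ({0, 2} \<subseteq> S) + of_bool ({1, 3} \<subseteq> S)) \<le> k * int (card S) - l"
    if S: "S \<subseteq> V" "2 \<le> card S" for S
  proof -
    define m where "m = card (S \<inter> A)"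
    have fin: "finite S" using S(1) V(1) finite_subset by blast
    have "S \<inter> A = S - {3}" using S(1) by (auto simp: A_def)
    then have cS: "card S = m + of_bool (3 \<in> S)"
      unfolding m_def using card_Suc_Diff1[OF fin, of 3] by (cases "3 \<in> S") auto
    have "card (N \<inter> S) + of_bool (1 \<in> S) = card (insert 1 N \<inter> S)"
      using N(3) \<open>1 \<notin> N\<close> by (cases "1 \<in> S") auto
    moreover have "card (insert 1 N \<inter> S) \<le> card (insert 1 N)"
      using N(3) by (intro card_mono) auto
    moreover have "card (insert 1 N) = K" using N(2,3) \<open>1 \<notin> N\<close> KL(3) by simp
    moreover have "card (insert 1 N \<inter> S) \<le> m"
      unfolding m_def using N(1) A(3) fin by (intro card_mono) auto
    ultimately have N1: "card (N \<inter> S) + of_bool (1 \<in> S) \<le> K" "card (N \<inter> S) + of_bool (1 \<in> S) \<le> m"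
      by auto
    have "sum \<mu> (pairs S) + of_bool ({0, 2} \<subseteq> S) + of_bool ({1, 3} \<subseteq> S) + L \<le> K * card S"
    proof (cases "2 \<le> m")
      case True
      moreover have "m \<le> 2 * K - 1" unfolding m_def A(2)[symmetric] using A(1) by (intro card_mono) auto
      ultimately have "(m choose 2) + (2 * K - 1) \<le> K * m" by (rule choose_two_bound)
      then show ?thesis
        unfolding sum\<mu>[OF S(1)] m_def[symmetric] cS using N1(1) KL(4)
        by (auto simp: algebra_simps)
    next
      case False
      then have "m = 1" "3 \<in> S" using cS S(2) by (auto split: if_splits simp: of_bool_def)
      moreover have "\<not> {0, 2} \<subseteq> S"
      proof
        assume "{0, 2} \<subseteq> S"
        then have "{0, 2} \<subseteq> S \<inter> A" using A(3) by auto
        then have "card {0, 2::nat} \<le> m" unfolding m_def using fin by (intro card_mono) auto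
        then show False using \<open>m = 1\<close> by simp
      qed
      ultimately show ?thesis
        unfolding sum\<mu>[OF S(1)] m_def[symmetric] cS using N1(2) KL(3,4) by (auto simp: binomial_eq_0)
    qed
    then show ?thesis unfolding KL(1,2) by (simp flip: of_nat_mult of_nat_add)
  qed
  moreover have "corresponding 0 2 1 3 a b c d V W" using V(2) W(2) by (auto simp: corresponding_def)
  moreover have "2 \<le> card V + card (W - {a, b, c, d})" using V(4) KL(3) by simp
  ultimately have main: "int (sum \<mu> (pairs V) + card (induced_edges \<Gamma> W))
         \<le> k * int (card V + card (W - {a, b, c, d})) - l"
    using gadget_sparse_iff[OF gad V(1,2), of \<mu>] W(1) by blast
  have "V \<inter> A = A" "N \<inter> V = N" using V(3) N(1) by auto
  \<comment> \<open>The 1 on the left is the clique edge \<open>{0, 2}\<close> missing from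
    \<open>\<mu>\<close>; \<open>{1, 3}\<close> is missing as well, whence \<open>K - 1\<close> for
    the vertex 3.\<close>
  then have "sum \<mu> (pairs V) + 1 = (2 * K - 1 choose 2) + (K - 1) + (2 * K - 1 - L)"
    using sum\<mu>[of V] V(2) A(2) N(2) by simp
  then have "int (sum \<mu> (pairs V)) + 1 = int (2 * K - 1 choose 2) + (int K - 1) + (2 * int K - 1 - int L)"
    using KL(3,4) by linarith
  moreover have "int (2 * K - 1 choose 2) = (2 * int K - 1) * (int K - 1)"
    using twice_choose_two[of "2 * K - 1"] KL(3) by (simp add: of_nat_diff algebra_simps)
  ultimately have "int (sum \<mu> (pairs V)) = 2 * int K * int K - int L - 2"
    by (simp only: algebra_simps)
  then show ?thesis using main V(4) unfolding KL(1,2) by (simp add: algebra_simps)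
qed

text \<open>The test graph is not sparse, so its replacement has a violating pair \<open>S\<close>,
  \<open>W\<close>. The two upper bounds already proved exclude every \<open>S\<close> other than
  \<open>P\<close>, and for \<open>S = P\<close> the parallel edges use up the whole bound on
  \<open>P\<close>.\<close>

lemma gadget_excess_on_pair:
  fixes k l :: int and P :: "nat set"
  assumes kl: "k \<ge> 2" "0 \<le> l" "l \<le> 2 * k - 1"
    and gad: "planarizing_gadget (sparse_graphs k l) \<Gamma> a b c d"
    and P: "P = {0, 2} \<or> P = {1, 3}"
  shows "\<exists>W\<subseteq>verts \<Gamma>. corresponding 0 2 1 3 a b c d P W \<and>
     int (card (induced_edges \<Gamma> W)) > k * int (card (W - {a, b, c, d}))"
proof -
  let ?T = "{a, b, c, d}"
  obtain u w where uw: "P = {u, w}" "u \<noteq> w" using P by (metis numeral_eq_one_iff semiring_norm(86) zero_neq_numeral)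
  have finP: "finite P" "card P = 2" "P \<subseteq> {0, 1, 2, 3}" using P by auto
  have \<Gamma>: "finite_multigraph \<Gamma>" "?T \<subseteq> verts \<Gamma>"
    using gad unfolding planarizing_gadget_def by blast+
  have finite4: "finite {0, 1, 2, 3 :: nat}" by simp
  \<comment> \<open>Together with the crossing edge, \<open>P\<close> spans one edge too many.\<close>
  define \<mu> where "\<mu> = (\<lambda>s. if s = {u, w} then nat (2 * k - l) else 0)"
  have sum\<mu>: "sum \<mu> (pairs S) = (if P \<subseteq> S then nat (2 * k - l) else 0)" if "finite S" for S
    unfolding \<mu>_def uw(1) using sum_pairs_single[OF that uw(2)] by simp
  have "\<not> int (sum \<mu> (pairs P) + of_bool ({0, 2} \<subseteq> P) + of_bool ({1, 3} \<subseteq> P)) \<le> k * int (card P) - l"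
  proof -
    have "of_bool ({0, 2} \<subseteq> P) + of_bool ({1, 3} \<subseteq> P) = (1 :: nat)"
      using P by (elim disjE) simp_all
    then have "sum \<mu> (pairs P) + of_bool ({0, 2} \<subseteq> P) + of_bool ({1, 3} \<subseteq> P) = nat (2 * k - l) + 1"
      unfolding sum\<mu>[OF finP(1)] by simp
    then show ?thesis using kl finP(2) by simp
  qed
  then have "\<not> (\<forall>S\<subseteq>{0, 1, 2, 3}. 2 \<le> card S \<longrightarrow>
       int (sum \<mu> (pairs S) + of_bool ({0, 2} \<subseteq> S) + of_bool ({1, 3} \<subseteq> S)) \<le> k * int (card S) - l)"
    using finP(2,3) by (intro notI) (drule spec[of _ P], simp)
  then obtain S W where SW: "S \<subseteq> {0, 1, 2, 3}" "W \<subseteq> verts \<Gamma>" "corresponding 0 2 1 3 a b c d S W"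
      "2 \<le> card S + card (W - ?T)"
    and viol: "int (sum \<mu> (pairs S) + card (induced_edges \<Gamma> W)) > k * int (card S + card (W - ?T)) - l"
    unfolding gadget_sparse_iff[OF gad finite4 order_refl] not_all not_imp not_le
    by (elim exE conjE)
  have finS: "finite S" using SW(1) finite_subset by blast
  have "P \<subseteq> S"
  \<comment> \<open>No parallel edge is counted in this case. As 4 is not in \<open>S\<close>, none
    is counted in the test graph for one terminal either, so its bound applies verbatim.\<close>
  proof (rule ccontr)
    assume "\<not> P \<subseteq> S"
    then have "int (card (induced_edges \<Gamma> W)) > k * int (card S + card (W - ?T)) - l"
      using viol sum\<mu>[OF finS] by simp
    moreover have "4 \<notin> S" using SW(1) by auto
    ultimately show False
      using gadget_bound_one_terminal[OF kl gad, of 0 S W] SW by auto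
  qed
  then have v: "int (card (induced_edges \<Gamma> W)) > k * (int (card S) - 2) + k * int (card (W - ?T))"
    using viol sum\<mu>[OF finS] kl by (simp add: algebra_simps)
  have "S = P"
  \<comment> \<open>A further terminal in \<open>S\<close> makes the excess greater than
    \<open>k \<ge> 2\<close>. Adding all terminals to \<open>W\<close> loses no edge and keeps the
    set of nonterminals, contradicting the bound with slack 2.\<close>
  proof (rule ccontr)
    assume "S \<noteq> P"
    then have "card P < card S" using \<open>P \<subseteq> S\<close> finS by (intro psubset_card_mono) auto
    then have "1 \<le> int (card S) - 2" using finP by simp
    then have "k \<le> k * (int (card S) - 2)" using kl by simp
    then have "int (card (induced_edges \<Gamma> W)) > k * int (card (W - ?T)) + 2" using v kl by linarith
    moreover have "card (induced_edges \<Gamma> W) \<le> card (induced_edges \<Gamma> (W \<union> ?T))"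
      using finite_induced_edges[OF \<Gamma>(1)] by (intro card_mono) (auto simp: induced_edges_def)
    moreover have "(W \<union> ?T) - ?T = W - ?T" by blast
    ultimately show False
      using gadget_bound_all_terminals[OF kl gad, of "W \<union> ?T"] SW(2) \<Gamma>(2) by simp
  qed
  then show ?thesis using SW v finP by auto
qed


section \<open>Linkages in a gadget\<close>

definition adjacent_in :: "('v, 'e) multigraph \<Rightarrow> 'v set \<Rightarrow> 'v \<Rightarrow> 'v \<Rightarrow> bool" where
  "adjacent_in G W x y \<longleftrightarrow> (\<exists>g\<in>induced_edges G W. ends G g = {x, y})"

definition subdrawing ::
  "('v, 'e) multigraph \<Rightarrow> ('v \<Rightarrow> complex) \<Rightarrow> ('e \<Rightarrow> real \<Rightarrow> complex) \<Rightarrow> 'v set \<Rightarrow> complex set" where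
  "subdrawing G p \<gamma> W = p ` W \<union> (\<Union>g\<in>induced_edges G W. path_image (\<gamma> g))"

lemma path_component_subdrawing:
  assumes "drawing G p \<gamma>" "(adjacent_in G W)\<^sup>*\<^sup>* x y" "x \<in> W"
  shows "path_component (subdrawing G p \<gamma> W) (p x) (p y)"
  using assms(2)
proof (induction rule: rtranclp_induct)
  case base
  show ?case using assms(3) by (auto simp: subdrawing_def path_component_refl_eq)
next
  case (step y z)
  from step(2) obtain g where g: "g \<in> induced_edges G W" "ends G g = {y, z}"
    by (auto simp: adjacent_in_def)
  then have "g \<in> edges G" by (simp add: induced_edges_def)
  then have \<gamma>: "simple_path (\<gamma> g)" "{pathstart (\<gamma> g), pathfinish (\<gamma> g)} = {p y, p z}"
    using assms(1) g(2) by (auto simp: drawing_def)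
  have "path_component (subdrawing G p \<gamma> W) (pathstart (\<gamma> g)) (pathfinish (\<gamma> g))"
    unfolding path_component_def using \<gamma>(1) g(1)
    by (intro exI[of _ "\<gamma> g"]) (auto simp: subdrawing_def simple_path_def)
  then have "path_component (subdrawing G p \<gamma> W) (p y) (p z)"
    using \<gamma>(2) by (auto simp: doubleton_eq_iff intro: path_component_sym)
  then show ?case using step.IH path_component_trans by blast
qed

text \<open>Curves of distinct edges share only vertices, and a curve contains no vertices but its
  ends, so a common point would be a vertex of both \<open>W\<close> and \<open>W'\<close>.\<close>

lemma subdrawings_disjoint:
  assumes G: "finite_multigraph G" "planar_embedding G p \<gamma>"
    and W: "W \<subseteq> verts G" "W' \<subseteq> verts G" "W \<inter> W' = {}"
  shows "subdrawing G p \<gamma> W \<inter> subdrawing G p \<gamma> W' = {}"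
proof -
  have D: "inj_on p (verts G)" "\<And>g. g \<in> edges G \<Longrightarrow> path_image (\<gamma> g) \<inter> p ` verts G = p ` ends G g"
    using G(2) by (auto simp: planar_embedding_def drawing_def)
  have pW: "p ` W \<inter> p ` W' = {}" using D(1) W by (auto dest!: inj_onD)
  have E: "g \<in> edges G" "ends G g \<subseteq> U" "path_image (\<gamma> g) \<inter> p ` verts G \<subseteq> p ` U"
    if "g \<in> induced_edges G U" for g U
    using that D(2)[of g] by (auto simp: induced_edges_def)
  have "path_image (\<gamma> g) \<inter> path_image (\<gamma> g') = {}"
    if g: "g \<in> induced_edges G W" and g': "g' \<in> induced_edges G W'" for g g'
  proof -
    \<comment> \<open>Nonempty ends ensure that no edge is induced by both of the disjoint
      sets.\<close>
    have "ends G g \<noteq> {}" using G(1) E(1)[OF g] by (auto simp: finite_multigraph_def)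
    then have "g \<noteq> g'" using E(2)[OF g] E(2)[OF g'] W(3) by blast
    then have "path_image (\<gamma> g) \<inter> path_image (\<gamma> g') \<subseteq> p ` verts G"
      using G(2) E(1)[OF g] E(1)[OF g'] by (auto simp: planar_embedding_def)
    then show ?thesis using E(3)[OF g] E(3)[OF g'] pW by blast
  qed
  moreover have "path_image (\<gamma> g) \<inter> p ` W' = {}" if "g \<in> induced_edges G W" for g
    using E(3)[OF that] pW W(2) by blast
  moreover have "path_image (\<gamma> g) \<inter> p ` W = {}" if "g \<in> induced_edges G W'" for g
    using E(3)[OF that] pW W(1) by blast
  ultimately show ?thesis using pW unfolding subdrawing_def by blast
qed

text \<open>The surrounding curve \<open>C\<close> runs in the outer face except at the terminals,
  so the drawing meets it there only. The two linkages then join alternating points of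
  \<open>C\<close> from within and must meet.\<close>

lemma no_disjoint_linkages:
  assumes G: "finite_multigraph G" "planar_embedding G p \<gamma>"
    and outer: "on_outer_face_in_order (drawn_set G p \<gamma>) (p a) (p c) (p b) (p d)"
    and W: "W \<subseteq> verts G" "W' \<subseteq> verts G" "a \<in> W" "c \<in> W'"
    and conn: "(adjacent_in G W)\<^sup>*\<^sup>* a b" "(adjacent_in G W')\<^sup>*\<^sup>* c d"
  shows "W \<inter> W' \<noteq> {}"
proof
  assume "W \<inter> W' = {}"
  then have disj: "subdrawing G p \<gamma> W \<inter> subdrawing G p \<gamma> W' = {}"
    by (rule subdrawings_disjoint[OF G W(1,2)])
  have dr: "drawing G p \<gamma>" using G(2) by (simp add: planar_embedding_def)
  obtain C r s t where C: "simple_path C" "pathfinish C = pathstart C" "0 < r" "r < s" "s < t" "t < 1"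
    and at: "C 0 = p a" "C r = p c" "C s = p b" "C t = p d"
    and out: "path_image C - {p a, p c, p b, p d} \<subseteq> outside (drawn_set G p \<gamma>)"
    and sub: "drawn_set G p \<gamma> \<subseteq> path_image C \<union> inside (path_image C)"
    using outer unfolding on_outer_face_in_order_def by (elim exE conjE)
  have sd: "subdrawing G p \<gamma> W \<union> subdrawing G p \<gamma> W' \<subseteq> drawn_set G p \<gamma>"
    using W by (auto simp: subdrawing_def drawn_set_def induced_edges_def)
  have "subdrawing G p \<gamma> W \<union> subdrawing G p \<gamma> W' \<subseteq> path_image C \<union> inside (path_image C)"
    using sd sub by (rule order_trans)
  moreover have "(subdrawing G p \<gamma> W \<union> subdrawing G p \<gamma> W') \<inter> path_image C \<subseteq> {C 0, C r, C s, C t}"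
    using sd out outside_no_overlap[of "drawn_set G p \<gamma>"] unfolding at by blast
  moreover have "path_component (subdrawing G p \<gamma> W) (C 0) (C s)"
    "path_component (subdrawing G p \<gamma> W') (C r) (C t)"
    unfolding at using path_component_subdrawing[OF dr conn(1) W(3)]
      path_component_subdrawing[OF dr conn(2) W(4)] by blast+
  ultimately have "subdrawing G p \<gamma> W \<inter> subdrawing G p \<gamma> W' \<noteq> {}"
    by (intro inscribed_paths_meet[OF C])
  then show False using disj by simp
qed

text \<open>Otherwise let \<open>R\<close> be the component of \<open>a\<close> in
  \<open>W - Z\<close>. No edge joins \<open>R\<close> to the rest of \<open>W - Z\<close>, so the
  edge counts of \<open>A = R \<union> Z\<close> and \<open>B = W - R\<close> add up to those of
  \<open>W\<close> and \<open>Z\<close>. Summing the upper bounds for \<open>A\<close> and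
  \<open>B\<close> then contradicts \<open>excess\<close> and \<open>Z\<close>.\<close>

lemma connected_by_excess:
  fixes k :: int
  assumes G: "finite_multigraph G"
    and W: "finite W" "a \<in> W" "b \<in> W" "a \<noteq> b" "Z \<subseteq> W - {a, b}"
    and upper: "\<And>U. U \<subseteq> W - {b} \<Longrightarrow> a \<in> U \<Longrightarrow> int (card (induced_edges G U)) \<le> k * int (card (U - {a}))"
      "\<And>U. U \<subseteq> W - {a} \<Longrightarrow> b \<in> U \<Longrightarrow> int (card (induced_edges G U)) \<le> k * int (card (U - {b}))"
    and excess: "int (card (induced_edges G W)) > k * int (card (W - {a, b}))"
    and Z: "int (card (induced_edges G Z)) \<ge> k * int (card Z)"
  shows "(adjacent_in G (W - Z))\<^sup>*\<^sup>* a b"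
proof (rule ccontr)
  assume nconn: "\<not> ?thesis"
  define R where "R = {x \<in> W - Z. (adjacent_in G (W - Z))\<^sup>*\<^sup>* a x}"
  define A where "A = R \<union> Z"
  define B where "B = W - R"
  have aA: "a \<in> A" "A \<subseteq> W - {b}" using W nconn by (auto simp: A_def R_def)
  have bB: "b \<in> B" "B \<subseteq> W - {a}" using W nconn by (auto simp: B_def R_def)
  have AB: "A \<inter> B = Z" "A \<union> B = W" using W by (auto simp: A_def B_def R_def)
  have step: "y \<in> R" if "x \<in> R" "adjacent_in G (W - Z) x y" for x y
  proof -
    have "y \<in> W - Z" using that(2) by (auto simp: adjacent_in_def induced_edges_def)
    then show ?thesis using that by (auto simp: R_def intro: rtranclp.rtrancl_into_rtrancl)
  qed
  have "ends G g \<subseteq> A \<or> ends G g \<subseteq> B" if g: "g \<in> induced_edges G W" for g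
  proof -
    have e: "g \<in> edges G" "ends G g \<subseteq> W" "card (ends G g) \<in> {1, 2}"
      using g G by (auto simp: induced_edges_def finite_multigraph_def)
    then obtain x y where xy: "ends G g = {x, y}"
      by (auto simp: card_1_singleton_iff card_2_iff)
    show ?thesis
    \<comment> \<open>\<open>Z\<close> lies in both \<open>A\<close> and \<open>B\<close>, so for an
      edge meeting \<open>Z\<close> the other end decides the side.\<close>
    proof (cases "x \<in> Z \<or> y \<in> Z")
      case True
      then show ?thesis using xy e(2) W by (auto simp: A_def B_def R_def)
    next
      case False
      then have "adjacent_in G (W - Z) x y" "adjacent_in G (W - Z) y x"
        using e xy by (auto simp: adjacent_in_def induced_edges_def insert_commute)
      then have "x \<in> R \<longleftrightarrow> y \<in> R" using step by blast
      then show ?thesis using xy e(2) by (auto simp: A_def B_def)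
    qed
  qed
  then have "induced_edges G W = induced_edges G A \<union> induced_edges G B"
    "induced_edges G Z = induced_edges G A \<inter> induced_edges G B"
    using AB by (auto simp: induced_edges_def)
  then have "card (induced_edges G W) + card (induced_edges G Z) = card (induced_edges G A) + card (induced_edges G B)"
    using card_Un_Int[of "induced_edges G A" "induced_edges G B"] finite_induced_edges[OF G] by simp
  moreover have "card (A - {a}) + card (B - {b}) = card (W - {a, b}) + card Z"
  proof -
    have "(A - {a}) \<union> (B - {b}) = W - {a, b}" "(A - {a}) \<inter> (B - {b}) = Z"
      using AB aA bB W by blast+
    moreover have "finite A" "finite B" using aA bB W(1) finite_subset by blast+
    ultimately show ?thesis using card_Un_Int[of "A - {a}" "B - {b}"] by simp
  qed
  then have "k * int (card (A - {a})) + k * int (card (B - {b})) = k * int (card (W - {a, b})) + k * int (card Z)"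
    by (simp flip: distrib_left of_nat_add)
  ultimately show False
    using upper(1)[OF aA(2,1)] upper(2)[OF bB(2,1)] excess Z by linarith
qed

section \<open>Uncrossing the two sets of positive excess\<close>

theorem theorem2:
  fixes k l :: int
  assumes "k \<ge> 2" and "0 \<le> l" and "l \<le> 2 * k - 1"
  shows "\<not> (\<exists>(\<Gamma> :: ('a, 'b) multigraph) a b c d.
           planarizing_gadget (sparse_graphs k l) \<Gamma> a b c d)"
proof (intro notI, elim exE)
  fix \<Gamma> :: "('a, 'b) multigraph" and a b c d
  assume gad: "planarizing_gadget (sparse_graphs k l) \<Gamma> a b c d"
  let ?T = "{a, b, c, d}"
  have \<Gamma>: "finite_multigraph \<Gamma>" "?T \<subseteq> verts \<Gamma>" "distinct [a, b, c, d]"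
    and "\<exists>p \<gamma>. planar_embedding \<Gamma> p \<gamma> \<and> on_outer_face_in_order (drawn_set \<Gamma> p \<gamma>) (p a) (p c) (p b) (p d)"
    using gad unfolding planarizing_gadget_def by blast+
  then obtain p \<gamma> where emb: "planar_embedding \<Gamma> p \<gamma>"
    and outer: "on_outer_face_in_order (drawn_set \<Gamma> p \<gamma>) (p a) (p c) (p b) (p d)" by blast
  have finV: "finite (verts \<Gamma>)" using \<Gamma>(1) by (simp add: finite_multigraph_def)
  \<comment> \<open>Taking \<open>S = {u, 4}\<close> for the vertex \<open>u\<close> identified with
    \<open>x\<close>, the parallel edges cancel against \<open>2 * k - l\<close>.\<close>
  have one: "int (card (induced_edges \<Gamma> U)) \<le> k * int (card (U - {x}))"
    if U: "U \<subseteq> verts \<Gamma>" "U \<inter> ?T = {x}" for U x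
  proof -
    have x: "x \<in> ?T" "x \<in> U" using U(2) by auto
    then obtain u :: nat where u: "u \<in> {0, 1, 2, 3}" "corresponding 0 2 1 3 a b c d {u, 4} U"
    proof -
      define u :: nat where "u = (if x = a then 0 else if x = b then 2 else if x = c then 1 else 3)"
      have "y \<in> U \<longleftrightarrow> y = x" if "y \<in> ?T" for y using U(2) that by blast
      then have "corresponding 0 2 1 3 a b c d {u, 4} U"
        using x(1) \<Gamma>(3) by (auto simp: corresponding_def u_def)
      then show thesis by (intro that[of u]) (auto simp: u_def)
    qed
    have "u \<noteq> 4" using u(1) by auto
    then have "int (nat (2 * k - l) + card (induced_edges \<Gamma> U)) \<le> k * int (2 + card (U - ?T)) - l"
      using gadget_bound_one_terminal[OF assms gad u(1) _ U(1) u(2)] u(1) by auto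
    moreover have "U - ?T = U - {x}" using U(2) by blast
    ultimately show ?thesis using assms by (simp add: algebra_simps)
  qed
  obtain X where X: "X \<subseteq> verts \<Gamma>" "corresponding 0 2 1 3 a b c d {0, 2 :: nat} X"
    "int (card (induced_edges \<Gamma> X)) > k * int (card (X - ?T))"
    using gadget_excess_on_pair[OF assms gad disjI1[OF refl]] by (elim exE conjE)
  obtain Y where Y: "Y \<subseteq> verts \<Gamma>" "corresponding 0 2 1 3 a b c d {1, 3 :: nat} Y"
    "int (card (induced_edges \<Gamma> Y)) > k * int (card (Y - ?T))"
    using gadget_excess_on_pair[OF assms gad disjI2[OF refl]] by (elim exE conjE)
  have XT: "a \<in> X" "b \<in> X" "c \<notin> X" "d \<notin> X" and YT: "a \<notin> Y" "b \<notin> Y" "c \<in> Y" "d \<in> Y"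
    using X(2) Y(2) by (auto simp: corresponding_def)
  have fin: "finite X" "finite Y" using X(1) Y(1) finV finite_subset by blast+
  define Z where "Z = X \<inter> Y"
  have "card (induced_edges \<Gamma> X) + card (induced_edges \<Gamma> Y)
      \<le> card (induced_edges \<Gamma> (X \<union> Y)) + card (induced_edges \<Gamma> Z)"
  proof -
    have "induced_edges \<Gamma> X \<inter> induced_edges \<Gamma> Y = induced_edges \<Gamma> Z"
      by (auto simp: induced_edges_def Z_def)
    moreover have "card (induced_edges \<Gamma> X \<union> induced_edges \<Gamma> Y) \<le> card (induced_edges \<Gamma> (X \<union> Y))"
      using finite_induced_edges[OF \<Gamma>(1)] by (intro card_mono) (auto simp: induced_edges_def)
    ultimately show ?thesis
      using card_Un_Int[of "induced_edges \<Gamma> X" "induced_edges \<Gamma> Y"] finite_induced_edges[OF \<Gamma>(1)] by simp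
  qed
  moreover have "card (X - ?T) + card (Y - ?T) = card ((X \<union> Y) - ?T) + card Z"
  proof -
    have "(X - ?T) \<union> (Y - ?T) = (X \<union> Y) - ?T" "(X - ?T) \<inter> (Y - ?T) = Z"
      using XT YT by (auto simp: Z_def)
    then show ?thesis using card_Un_Int[of "X - ?T" "Y - ?T"] fin by simp
  qed
  then have "k * int (card (X - ?T)) + k * int (card (Y - ?T)) = k * int (card ((X \<union> Y) - ?T)) + k * int (card Z)"
    by (simp flip: distrib_left of_nat_add)
  moreover have "int (card (induced_edges \<Gamma> (X \<union> Y))) \<le> k * int (card ((X \<union> Y) - ?T)) + 2"
    using X(1) Y(1) XT YT by (intro gadget_bound_all_terminals[OF assms gad]) auto
  \<comment> \<open>The strict excesses of \<open>X\<close> and \<open>Y\<close> contribute at least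
    1 each, which exactly offsets the slack 2 in the bound for \<open>X \<union> Y\<close>.\<close>
  ultimately have Z: "int (card (induced_edges \<Gamma> Z)) \<ge> k * int (card Z)"
    using X(3) Y(3) by linarith
  have "(adjacent_in \<Gamma> (X - Z))\<^sup>*\<^sup>* a b"
  proof (rule connected_by_excess[OF \<Gamma>(1) fin(1) XT(1,2) _ _ _ _ _ Z])
    show "a \<noteq> b" "Z \<subseteq> X - {a, b}" using \<Gamma>(3) YT by (auto simp: Z_def)
    have "X - ?T = X - {a, b}" using XT by blast
    then show "k * int (card (X - {a, b})) < int (card (induced_edges \<Gamma> X))" using X(3) by simp
    show "int (card (induced_edges \<Gamma> U)) \<le> k * int (card (U - {a}))" if "U \<subseteq> X - {b}" "a \<in> U" for U
      using that X(1) XT by (intro one) auto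
    show "int (card (induced_edges \<Gamma> U)) \<le> k * int (card (U - {b}))" if "U \<subseteq> X - {a}" "b \<in> U" for U
      using that X(1) XT by (intro one) auto
  qed
  \<comment> \<open>Only one of the two linkages has to avoid \<open>Z\<close>. Here the separator
    is empty, which makes its counting condition trivial.\<close>
  moreover have "(adjacent_in \<Gamma> (Y - {}))\<^sup>*\<^sup>* c d"
  proof (rule connected_by_excess[OF \<Gamma>(1) fin(2) YT(3,4)])
    show "c \<noteq> d" using \<Gamma>(3) by simp
    have "Y - ?T = Y - {c, d}" using YT by blast
    then show "k * int (card (Y - {c, d})) < int (card (induced_edges \<Gamma> Y))" using Y(3) by simp
    show "int (card (induced_edges \<Gamma> U)) \<le> k * int (card (U - {c}))" if "U \<subseteq> Y - {d}" "c \<in> U" for U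
      using that Y(1) YT by (intro one) auto
    show "int (card (induced_edges \<Gamma> U)) \<le> k * int (card (U - {d}))" if "U \<subseteq> Y - {c}" "d \<in> U" for U
      using that Y(1) YT by (intro one) auto
  qed simp_all
  ultimately have "(X - Z) \<inter> (Y - {}) \<noteq> {}"
    using X(1) Y(1) XT YT
    by (intro no_disjoint_linkages[OF \<Gamma>(1) emb outer]) (auto simp: Z_def)
  then show False by (auto simp: Z_def)
qed

end
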